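(* Let $g$ be a Sturmian sequence over $\{0,1\}$ with associated sequence of lower Christoffel words $01=w_0,w_1,w_2,\ldots$, and let $n\ge 2$. Let $\nu$ be the unique integer with $|w_{\nu-1}|\le n\le |w_\nu|-1$, let $N=|w_\nu|$, $q=|w_\nu|_0$, let $w_\nu=w'_\nu w''_\nu$ be the standard factorization, and let $\epsilon$ be the sign of the permutation $x\mapsto |w_\nu|_1x$ of the set of nonzero residues modulo $N$. Then: (1) If $n=N-1$, then $V_n$ equals $\epsilon$ times the lower Christoffel word over the alphabet $\{-|w'_\nu|_1<|w''_\nu|_1\}$ with $|w''_\nu|$ letters $-|w'_\nu|_1$ and $|w'_\nu|$ letters $|w''_\nu|_1$. (2) If $|w_{\nu-1}|\le n<N-1$, let $i=N-1-n$. Then $V_n$ equals $\epsilon(-1)^t$ times the word associated with the composition $(|w''_\nu|-i,\ i,\ |w'_\nu|-i)$ over the alphabet $\{-|w'_\nu|_1<|w''_\nu|_1-|w'_\nu|_1<|w''_\nu|_1\}$, where $$t=\sum_{1\le j\le i}\big(N-j+d_j-(jq\bmod N)\big),$$ and $d_j$ denotes the number of $j'\in\{1,\ldots,j\}$ such that $j'q\bmod N$ is smaller than $jq\bmod N$.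
   Context: Words are finite sequences; a word whose letters are numbers is identified with the vector of its letters; positions, rows and columns are indexed from $0$. For a word $u$ over $\{0,1\}$, $|u|$ is its length, $|u|_0,|u|_1$ its numbers of $0$'s and $1$'s. A factor of an infinite sequence is a finite block of consecutive letters. A Sturmian sequence over $\{0,1\}$ is an infinite sequence having exactly $m+1$ distinct factors of length $m$ for each $m\ge0$; its slope is $s=\lim |u|_1/|u|_0$ over factors $u$ with $|u|\to\infty$. For coprime integers $p,q\ge 0$ with $p+q=M\ge1$ and an ordered alphabet $\{x<y\}$, the lower Christoffel word with $p$ letters $x$ and $q$ letters $y$ is $c_0\cdots c_{M-1}$ with $c_i=y$ if $\lfloor (i+1)q/M\rfloor>\lfloor iq/M\rfloor$ and $c_i=x$ otherwise; over $\{0<1\}$ its slope is $q/p$. Every lower Christoffel word $w$ over $\{0<1\}$ of length $\ge 2$ factors uniquely as $w=w'w''$ with $w',w''$ lower Christoffel words (standard factorization). The associated sequence of lower Christoffel words of $g$ is $w_0=01,w_1,\ldots$, where $w_k$ is the lower Christoffel word over $\{0<1\}$ whose slope is the $k$-th node ($k=0$ being the root $1/1$) on the infinite path in the Stern–Brocot tree from the root towards $s$. For $m\ge1$, $G_m$ is the $(m+1)\times m$ matrix whose rows are the $m+1$ factors of length $m$ of $g$ in decreasing lexicographic order ($0<1$) from top to bottom. For a $(k+1)\times k$ matrix $A$ with rows $L_0,\ldots,L_k$, $D(A)=(a_0,\ldots,a_k)$ with $a_i=(-1)^{k-i}\det(L_0,\ldots,\widehat{L_i},\ldots,L_k)$;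 $V_m=D(G_m)$ is the $m$-th determinantal vector of $g$. Word associated with a composition: for nonnegative integers $c_1,c_2,c_3$ with sum $m$, let $I_1=\{0,\ldots,c_1-1\}$, $I_2=\{c_1,\ldots,c_1+c_2-1\}$, $I_3=\{c_1+c_2,\ldots,m-1\}$, and let $\sigma$ be the permutation of $\{0,\ldots,m-1\}$ with $\sigma(i)=i+c_2+c_3$ on $I_1$, $\sigma(i)=i+c_3-c_1$ on $I_2$, $\sigma(i)=i-c_1-c_2$ on $I_3$. When $\sigma$ is a single $m$-cycle, the word associated with $(c_1,c_2,c_3)$ over an ordered alphabet $\{x<y<z\}$ is $\ell(0)\ell(\sigma(0))\cdots\ell(\sigma^{m-1}(0))$, where $\ell(i)=x,y,z$ according as $i\in I_1,I_2,I_3$ (such words are perfectly clustering). *)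

theory Defs
  imports
    Jordan_Normal_Form.Determinant
    "HOL-Combinatorics.Orbits"
    "HOL-Library.List_Lexorder"
    Complex_Main
begin

definition factors :: "(nat \<Rightarrow> 'a) \<Rightarrow> 'a list set" where
  "factors g = {map g [k..<k + m] | k m. True}"

definition factors_of_length :: "(nat \<Rightarrow> 'a) \<Rightarrow> nat \<Rightarrow> 'a list set" where
  "factors_of_length g m = {u \<in> factors g. length u = m}"

definition sturmian :: "(nat \<Rightarrow> int) \<Rightarrow> bool" where
  "sturmian g \<longleftrightarrow> range g \<subseteq> {0, 1} \<and> (\<forall>m. card (factors_of_length g m) = m + 1)"

text \<open>The filter describes factors whose length tends to infinity. A Sturmian sequence has only
  finitely many factors without the letter 0, so division by zero does not affect the limit.\<close>

definition slope :: "(nat \<Rightarrow> int) \<Rightarrow> real" where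
  "slope g = Lim (inf (filtercomap length at_top) (principal (factors g)))
     (\<lambda>u. real (count_list u 1) / real (count_list u 0))"

text \<open>For natural numbers, \<open>div\<close> is the floor of the quotient.\<close>

definition christoffel_word :: "'a \<Rightarrow> 'a \<Rightarrow> nat \<Rightarrow> nat \<Rightarrow> 'a list" where
  "christoffel_word x y p q =
     map (\<lambda>i. if (i + 1) * q div (p + q) > i * q div (p + q) then y else x) [0..<p + q]"

text \<open>Coprimality excludes \<open>p = q = 0\<close>, so these words are nonempty; the words \<open>[0]\<close> and
  \<open>[1]\<close> are included.\<close>

definition lower_christoffel :: "int list \<Rightarrow> bool" where
  "lower_christoffel w \<longleftrightarrow> (\<exists>p q. coprime p q \<and> w = christoffel_word 0 1 p q)"

definition standard_factorization :: "int list \<Rightarrow> int list \<Rightarrow> int list \<Rightarrow> bool" where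
  "standard_factorization w w' w'' \<longleftrightarrow>
     lower_christoffel w' \<and> lower_christoffel w'' \<and> w = w' @ w''"

text \<open>The node of the Stern--Brocot tree at depth \<open>k\<close> on the path towards \<open>s\<close> is the mediant
  \<open>(a + c) / (b + d)\<close> of the \<open>k\<close>-th interval, whose end points \<open>a / b\<close> and \<open>c / d\<close> are stored
  as pairs (numerator, denominator); \<open>(1, 0)\<close> stands for infinity. The path never ends, since
  the case that \<open>s\<close> equals a node does not arise for irrational \<open>s\<close>.\<close>

definition mediant :: "nat \<times> nat \<Rightarrow> nat \<times> nat \<Rightarrow> nat \<times> nat" where
  "mediant l r = (fst l + fst r, snd l + snd r)"

primrec stern_brocot_interval :: "real \<Rightarrow> nat \<Rightarrow> (nat \<times> nat) \<times> (nat \<times> nat)" where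
  "stern_brocot_interval s 0 = ((0, 1), (1, 0))"
| "stern_brocot_interval s (Suc k) =
     (let (l, r) = stern_brocot_interval s k; m = mediant l r
      in if s < real (fst m) / real (snd m) then (l, m) else (m, r))"

definition stern_brocot_node :: "real \<Rightarrow> nat \<Rightarrow> nat \<times> nat" where
  "stern_brocot_node s k = (let (l, r) = stern_brocot_interval s k in mediant l r)"

text \<open>The word with \<open>p\<close> zeros and \<open>q\<close> ones has slope \<open>q / p\<close>.\<close>

definition associated_word :: "(nat \<Rightarrow> int) \<Rightarrow> nat \<Rightarrow> int list" where
  "associated_word g k =
     (let (q, p) = stern_brocot_node (slope g) k in christoffel_word 0 1 p q)"

definition factor_matrix :: "(nat \<Rightarrow> int) \<Rightarrow> nat \<Rightarrow> int mat" where
  "factor_matrix g m = mat_of_rows_list m (rev (sorted_list_of_set (factors_of_length g m)))"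

definition delete_row :: "'a mat \<Rightarrow> nat \<Rightarrow> 'a mat" where
  "delete_row A i = mat_of_rows (dim_col A) (take i (rows A) @ drop (Suc i) (rows A))"

definition minor_vec :: "'a :: comm_ring_1 mat \<Rightarrow> 'a vec" where
  "minor_vec A = vec (dim_col A + 1) (\<lambda>i. (-1) ^ (dim_col A - i) * det (delete_row A i))"

definition determinantal_vec :: "(nat \<Rightarrow> int) \<Rightarrow> nat \<Rightarrow> int vec" where
  "determinantal_vec g m = minor_vec (factor_matrix g m)"

text \<open>The additions precede the subtractions, so that no subtraction on \<^typ>\<open>nat\<close> is truncated
  for \<open>i < c1 + c2 + c3\<close>.\<close>

definition composition_perm :: "nat \<Rightarrow> nat \<Rightarrow> nat \<Rightarrow> nat \<Rightarrow> nat" where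
  "composition_perm c1 c2 c3 i =
     (if i < c1 then i + c2 + c3
      else if i < c1 + c2 then i + c3 - c1
      else if i < c1 + c2 + c3 then i - c1 - c2
      else i)"

definition single_cycle :: "nat \<Rightarrow> nat \<Rightarrow> nat \<Rightarrow> bool" where
  "single_cycle c1 c2 c3 \<longleftrightarrow> cyclic_on (composition_perm c1 c2 c3) {0..<c1 + c2 + c3}"

definition composition_word :: "'a \<Rightarrow> 'a \<Rightarrow> 'a \<Rightarrow> nat \<Rightarrow> nat \<Rightarrow> nat \<Rightarrow> 'a list" where
  "composition_word x y z c1 c2 c3 =
     map (\<lambda>k. let i = (composition_perm c1 c2 c3 ^^ k) 0
              in if i < c1 then x else if i < c1 + c2 then y else z)
       [0..<c1 + c2 + c3]"

definition rank_count :: "nat \<Rightarrow> nat \<Rightarrow> nat \<Rightarrow> nat" where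
  "rank_count N q j = card {j' \<in> {1..j}. j' * q mod N < j * q mod N}"

text \<open>The sum is taken over the integers to avoid truncated subtraction. It is nonnegative for
  \<open>i < N\<close> and \<open>q\<close> coprime to \<open>N\<close>; \<open>(-1) ^ nat \<bar>t\<bar>\<close> is \<open>(-1)\<close> to the power \<open>t\<close> for an integer \<open>t\<close> of either sign.\<close>

definition sign_exponent :: "nat \<Rightarrow> nat \<Rightarrow> nat \<Rightarrow> int" where
  "sign_exponent N q i =
     (\<Sum>j = 1..i. int N - int j + int (rank_count N q j) - int (j * q mod N))"

end

theory Submission
  imports Defs "HOL-Number_Theory.Cong"
begin

text \<open>Complexity \<open>m + 1\<close> forces \<open>g\<close> to be balanced with irrational density \<open>\<alpha>\<close>. Since no fraction with
  denominator below \<open>N\<close> separates \<open>\<alpha>\<close> from \<open>a / N\<close>, where \<open>a\<close> is the number of ones of \<open>w\<close>, the factors of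
  length \<open>N - 1\<close> are the words with partial sums \<open>\<lfloor>(j a + \<rho>) / N\<rfloor>\<close>, \<open>0 \<le> \<rho> < N\<close>. In terms of partial sums the
  \<open>j\<close>-th column of \<open>G\<close> is, up to the constant \<open>\<lfloor>j a / N\<rfloor>\<close>, a step whose position is the rank of
  \<open>j a mod N\<close>. Orthogonality of the determinantal vector \<open>V\<close> to these columns gives the partial sums of
  \<open>V\<close> as multiples of the sum \<open>T\<close> of its entries, so its entries are \<open>T\<close> times differences of consecutive values
  \<open>\<lfloor>j a / N\<rfloor>\<close> when \<open>j\<close> runs through \<open>0, \<dots>, n\<close> in the order of \<open>j a mod N\<close>. Passing to the successor in this order
  is the exchange of three intervals given by the composition, and \<open>T\<close> is the sign of the permutation sorting the residues
  \<open>j a mod N\<close>.\<close>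

section \<open>Sturmian sequences are balanced\<close>

text \<open>The hypothesis is a complexity count, so no representation of \<open>g\<close> by a line
  is at hand, and counting replaces it. Every window of length \<open>N - 1\<close> is one of at
  most \<open>N\<close> mechanical words, which the \<open>N\<close> factors of that length then
  exhaust; likewise \<open>n + 1\<close> distinct words must be all rows of the matrix.
  Irrationality of \<alpha> keeps every comparison with Stern-Brocot end points strict. The lengths
  of these ends turn out to be those of \<open>w'\<close> and \<open>w''\<close>, and the lower
  bound on \<open>n\<close> makes \<open>i\<close> smaller than both. Modulo \<open>N\<close>,
  \<open>k\<close> inverts \<open>a\<close> and \<open>k'\<close> inverts \<open>- a\<close>, so
  \<open>j + k\<close> and \<open>j - k'\<close> both carry the residue after that of
  \<open>j\<close>. With indices limited to \<open>0, ..., n\<close> some successors are missing and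
  one residue is skipped: this is the middle interval. For \<open>n = N - 1\<close> nothing is
  skipped, and a rotation, hence a Christoffel word, remains. The sign is first found for the full
  set of residues, where it is that of a permutation; the inversions formed by the \<open>i\<close>
  removed indices then add up to \<open>t\<close>.\<close>

definition window :: "(nat \<Rightarrow> 'a) \<Rightarrow> nat \<Rightarrow> nat \<Rightarrow> 'a list" where
  "window g i m = map g [i..<i + m]"

lemma length_window [simp]: "length (window g i m) = m"
  by (simp add: window_def)

lemma nth_window [simp]: "t < m \<Longrightarrow> window g i m ! t = g (i + t)"
  by (simp add: window_def)

lemma window_eq_iff: "window g i m = window h j m \<longleftrightarrow> (\<forall>t<m. g (i + t) = h (j + t))"
  by (auto simp: list_eq_iff_nth_eq)

lemma window_Suc: "window g i (Suc m) = window g i m @ [g (i + m)]"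
  by (simp add: window_def)

lemma window_Suc': "window g i (Suc m) = g i # window g (Suc i) m"
  by (simp add: window_def upt_conv_Cons del: upt_Suc)

lemma factors_of_length_eq: "factors_of_length g m = range (\<lambda>i. window g i m)"
  by (auto simp: factors_of_length_def factors_def window_def)

lemma window_in_factors [simp]: "window g i m \<in> factors_of_length g m"
  by (simp add: factors_of_length_eq)

lemma sturmian_letters: "sturmian g \<Longrightarrow> g i = 0 \<or> g i = 1"
  unfolding sturmian_def by blast

lemma sturmian_card: "sturmian g \<Longrightarrow> card (factors_of_length g m) = Suc m"
  unfolding sturmian_def by simp

lemma sturmian_finite: "sturmian g \<Longrightarrow> finite (factors_of_length g m)"
  using sturmian_card[of g m] card.infinite by fastforce

text \<open>Shifting back by \<open>p\<close> moves any window to a start below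
  \<open>K + p\<close>, which leaves at most \<open>K + p\<close> factors of length
  \<open>K + p\<close>, one too few.\<close>

lemma sturmian_not_eventually_periodic:
  assumes "sturmian g" and "p \<ge> 1" and per: "\<And>i. i \<ge> K \<Longrightarrow> g (i + p) = g i"
  shows False
proof -
  have red: "\<exists>j<K + p. window g i m = window g j m" for i m
  proof (induction i rule: less_induct)
    case (less i)
    show ?case
    proof (cases "i < K + p")
      case False
      have "window g i m = window g (i - p) m"
        unfolding window_eq_iff
      proof (intro allI impI)
        fix t assume "t < m"
        show "g (i + t) = g (i - p + t)"
          using per[of "i - p + t"] False by (simp add: algebra_simps)
      qed
      then show ?thesis using less.IH[of "i - p"] False \<open>p \<ge> 1\<close> by auto
    qed auto
  qed
  have "factors_of_length g (K + p) \<subseteq> (\<lambda>i. window g i (K + p)) ` {..<K + p}"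
    using red by (fastforce simp: factors_of_length_eq)
  then have "card (factors_of_length g (K + p)) \<le> K + p"
    by (metis card_image_le card_lessThan finite_imageI finite_lessThan card_mono le_trans)
  then show False using sturmian_card[OF assms(1), of "K + p"] by simp
qed

section \<open>Right special factors\<close>

definition right_special :: "(nat \<Rightarrow> int) \<Rightarrow> nat \<Rightarrow> int list set" where
  "right_special g m = {u. u @ [0] \<in> factors_of_length g (Suc m) \<and>
                           u @ [1] \<in> factors_of_length g (Suc m)}"

text \<open>Every factor extends to the right in one or two ways; the growth of the complexity by
  one counts those extending in two.\<close>

lemma card_right_special:
  assumes "sturmian g"
  shows "card (right_special g m) = 1"
proof -
  define A where "A = (\<lambda>b. {u. u @ [b] \<in> factors_of_length g (Suc m)})"
  have sub: "A b \<subseteq> factors_of_length g m" for b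
    by (auto simp: A_def factors_of_length_eq window_Suc)
  have fin: "finite (A b)" for b
    using sub sturmian_finite[OF assms] finite_subset by blast
  have un: "A 0 \<union> A 1 = factors_of_length g m"
  proof
    show "factors_of_length g m \<subseteq> A 0 \<union> A 1"
    proof
      fix u assume "u \<in> factors_of_length g m"
      then obtain i where "u = window g i m" by (auto simp: factors_of_length_eq)
      then have "u @ [g (i + m)] \<in> factors_of_length g (Suc m)"
        by (metis window_Suc window_in_factors)
      then show "u \<in> A 0 \<union> A 1"
        using sturmian_letters[OF assms, of "i + m"] by (auto simp: A_def)
    qed
  qed (use sub in auto)
  have split: "factors_of_length g (Suc m) = (\<lambda>u. u @ [0]) ` A 0 \<union> (\<lambda>u. u @ [1]) ` A 1"
  proof
    show "factors_of_length g (Suc m) \<subseteq> (\<lambda>u. u @ [0]) ` A 0 \<union> (\<lambda>u. u @ [1]) ` A 1"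
    proof
      fix u assume u: "u \<in> factors_of_length g (Suc m)"
      then obtain i where i: "u = window g i m @ [g (i + m)]"
        by (auto simp: factors_of_length_eq window_Suc)
      then have "window g i m \<in> A (g (i + m))" using u by (simp add: A_def)
      then show "u \<in> (\<lambda>u. u @ [0]) ` A 0 \<union> (\<lambda>u. u @ [1]) ` A 1"
        using sturmian_letters[OF assms, of "i + m"] i by auto
    qed
  qed (auto simp: A_def)
  have "card (factors_of_length g (Suc m)) = card (A 0) + card (A 1)"
    unfolding split
    by (subst card_Un_disjoint) (auto simp: fin card_image inj_on_def)
  moreover have "card (A 0) + card (A 1) = card (factors_of_length g m) + card (A 0 \<inter> A 1)"
    using card_Un_Int[OF fin fin, of 0 1] un by simp
  moreover have "A 0 \<inter> A 1 = right_special g m"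
    by (auto simp: A_def right_special_def)
  ultimately show ?thesis using sturmian_card[OF assms] by simp
qed

lemma right_special_unique:
  assumes "sturmian g" and "u \<in> right_special g m" and "v \<in> right_special g m"
  shows "u = v"
  using card_right_special[OF assms(1), of m] assms(2,3)
  by (metis card_1_singletonE singletonD)

lemma next_letter_determined:
  assumes "sturmian g" and "window g i m = window g j m" and "window g i m \<notin> right_special g m"
  shows "window g (Suc i) m = window g (Suc j) m"
proof -
  have "window g i m @ [g (i + m)] \<in> factors_of_length g (Suc m)"
    "window g i m @ [g (j + m)] \<in> factors_of_length g (Suc m)"
    by (metis window_Suc window_in_factors assms(2))+
  then have "g (i + m) = g (j + m)"
    using assms(3) sturmian_letters[OF assms(1)] unfolding right_special_def
    by (metis (no_types, lifting) mem_Collect_eq)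
  then have "window g i (Suc m) = window g j (Suc m)"
    using assms(2) by (simp add: window_Suc)
  then show ?thesis by (simp add: window_Suc')
qed

text \<open>Away from right special windows the current window determines the next, so a repetition
  at \<open>i\<close> and \<open>j\<close> cycles forever and \<open>g\<close> has period
  \<open>j - i\<close> from \<open>i\<close> on.\<close>

lemma repeated_window_not_between_right_special:
  assumes st: "sturmian g" and "i < j" and "m \<ge> 1" and eq: "window g i m = window g j m"
    and ns: "\<And>x. i \<le> x \<Longrightarrow> x < j \<Longrightarrow> window g x m \<notin> right_special g m"
  shows False
proof -
  \<comment> \<open>The second conjunct keeps every later window among those starting in
    \<open>i, ..., j - 1\<close>, where \<open>ns\<close> applies.\<close>
  have "window g (i + t) m = window g (j + t) m \<and>
        (\<exists>x. i \<le> x \<and> x < j \<and> window g (i + t) m = window g x m)" for t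
  proof (induction t)
    case 0
    then show ?case using eq \<open>i < j\<close> by auto
  next
    case (Suc t)
    then obtain x where x: "i \<le> x" "x < j" "window g (i + t) m = window g x m"
      and e: "window g (i + t) m = window g (j + t) m" by blast
    have nr: "window g (i + t) m \<notin> right_special g m" using x ns by metis
    have 1: "window g (i + Suc t) m = window g (j + Suc t) m"
      using next_letter_determined[OF st e nr] by simp
    have 2: "window g (i + Suc t) m = window g (Suc x) m"
      using next_letter_determined[OF st x(3) nr] by simp
    show ?case
    proof (cases "Suc x = j")
      case True
      then show ?thesis using 1 2 eq \<open>i < j\<close> by (metis order_refl)
    next
      case False
      then show ?thesis using 1 2 x by (metis Suc_lessI le_SucI)
    qed
  qed
  then have w: "window g (i + t) m = window g (j + t) m" for t by blast
  have "g (i + t) = g (j + t)" for t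
    using w[of t] \<open>m \<ge> 1\<close> unfolding window_eq_iff by (metis add.right_neutral less_eq_Suc_le One_nat_def)
  then have per: "g (x + (j - i)) = g x" if "x \<ge> i" for x
  proof -
    have "i + (x - i) = x" "j + (x - i) = x + (j - i)" using that \<open>i < j\<close> by simp_all
    then show ?thesis using \<open>\<And>t. g (i + t) = g (j + t)\<close>[of "x - i"] by metis
  qed
  show False
    by (rule sturmian_not_eventually_periodic[OF st _ per]) (use \<open>i < j\<close> in simp_all)
qed

text \<open>The word \<open>w\<close> with \<open>b w b\<close> and \<open>c w c\<close> both factors is right special; minimality forces \<open>c w\<close>
  to stay away from \<open>b w b\<close> long enough for the pigeonhole principle to produce a period.\<close>

lemma no_unbalanced_pair_aux:
  assumes st: "sturmian g" and bc: "b \<noteq> c"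
    and i: "g i = b" "g (i + n + 1) = b" and j: "g j = c" "g (j + n + 1) = c"
    and mid: "\<And>t. t < n \<Longrightarrow> g (i + 1 + t) = g (j + 1 + t)"
    and min: "\<And>m x y. m < n \<Longrightarrow> g x = b \<Longrightarrow> g (x + m + 1) = b \<Longrightarrow> g y = c \<Longrightarrow> g (y + m + 1) = c
        \<Longrightarrow> \<exists>t<m. g (x + 1 + t) \<noteq> g (y + 1 + t)"
    and spec: "c # window g (i + 1) n \<in> right_special g (n + 1)"
  shows False
proof -
  have no: "window g (i + 1 + d) (n + 1) \<noteq> c # window g (i + 1) n" if "d \<le> n" for d
  proof
    assume "window g (i + 1 + d) (n + 1) = c # window g (i + 1) n"
    then have c: "g (i + 1 + d) = c" and "window g (i + 2 + d) n = window g (i + 1) n"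
      by (simp_all add: window_Suc')
    then have w: "g (i + 2 + d + t) = g (i + 1 + t)" if "t < n" for t
      using that unfolding window_eq_iff by blast
    have "d \<noteq> n" using c i(2) bc by (auto simp: add_ac)
    then have "d < n" using that by simp
    \<comment> \<open>The overlap of \<open>c w\<close> with \<open>b w b\<close> yields a shorter
      word \<open>u\<close> of length \<open>m\<close>, with \<open>b u b\<close> at
      \<open>i\<close> and \<open>c u c\<close> at \<open>j + 1 + d\<close>, against
      minimality.\<close>
    define m where "m = n - 1 - d"
    have "g (j + 1 + d) = c" using mid[of d] c \<open>d < n\<close> by simp
    moreover have "g (j + 1 + d + m + 1) = c" using j(2) \<open>d < n\<close> by (simp add: m_def add_ac)
    moreover have "g (i + m + 1) = b"
    proof -
      have "g (i + 2 + d + m) = g (i + 1 + m)" using w[of m] \<open>d < n\<close> by (simp add: m_def)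
      moreover have "i + 2 + d + m = i + n + 1" using \<open>d < n\<close> by (simp add: m_def)
      moreover have "i + 1 + m = i + m + 1" by simp
      ultimately show ?thesis using i(2) by metis
    qed
    moreover have "g (i + 1 + t) = g (j + 1 + d + 1 + t)" if "t < m" for t
    proof -
      have "g (i + 1 + t) = g (i + 1 + (d + 1 + t))"
        using w[of t] that by (simp add: m_def add_ac)
      also have "\<dots> = g (j + 1 + (d + 1 + t))"
        using mid[of "d + 1 + t"] that by (simp add: m_def)
      finally show ?thesis by (simp add: add_ac)
    qed
    ultimately show False using min[of m i "j + 1 + d"] i(1) \<open>d < n\<close> by (auto simp: m_def)
  qed
  have nsp: "window g x (n + 1) \<notin> right_special g (n + 1)" if "x \<in> {i..i + n + 1}" for x
  proof
    assume "window g x (n + 1) \<in> right_special g (n + 1)"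
    then have eq: "window g x (n + 1) = c # window g (i + 1) n"
      using right_special_unique[OF st _ spec] by blast
    show False
    proof (cases "x = i")
      case True
      then show False using eq i(1) bc by (simp add: window_Suc')
    next
      case False
      then have "i + 1 + (x - i - 1) = x" "x - i - 1 \<le> n" using that by auto
      then show False using no[of "x - i - 1"] eq by metis
    qed
  qed
  define R where "R = c # window g (i + 1) n"
  \<comment> \<open>The \<open>n + 2\<close> starting positions share the \<open>n + 1\<close>
    factors other than \<open>R\<close>.\<close>
  have sub: "(\<lambda>x. window g x (n + 1)) ` {i..i + n + 1} \<subseteq> factors_of_length g (n + 1) - {R}"
    using nsp spec unfolding R_def by (metis (no_types, lifting) Diff_iff image_subsetI singletonD window_in_factors)
  have R_in: "R \<in> factors_of_length g (n + 1)"
  proof -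
    obtain y where "window g y (Suc (n + 1)) = R @ [0]"
      using spec unfolding R_def right_special_def factors_of_length_eq by auto
    then have "R = window g y (n + 1)" unfolding window_Suc by simp
    then show ?thesis by simp
  qed
  have "card (factors_of_length g (n + 1) - {R}) = n + 1"
    using sturmian_card[OF st, of "n + 1"] sturmian_finite[OF st] R_in by simp
  then have "card ((\<lambda>x. window g x (n + 1)) ` {i..i + n + 1}) < card {i..i + n + 1}"
    using card_mono[OF _ sub] sturmian_finite[OF st] by simp
  then have "\<not> inj_on (\<lambda>x. window g x (n + 1)) {i..i + n + 1}"
    using card_image by fastforce
  then obtain x y where xy: "x < y" "x \<in> {i..i + n + 1}" "y \<in> {i..i + n + 1}"
      "window g x (n + 1) = window g y (n + 1)"
    unfolding inj_on_def by (metis linorder_neqE_nat)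
  show False
    using repeated_window_not_between_right_special[OF st xy(1) _ xy(4)] nsp xy(2,3) by auto
qed

section \<open>Block sums and balance\<close>

definition block_sum :: "(nat \<Rightarrow> int) \<Rightarrow> nat \<Rightarrow> nat \<Rightarrow> int" where
  "block_sum g i k = (\<Sum>t<k. g (i + t))"

lemma block_sum_0 [simp]: "block_sum g i 0 = 0"
  by (simp add: block_sum_def)

lemma block_sum_Suc: "block_sum g i (Suc k) = block_sum g i k + g (i + k)"
  by (simp add: block_sum_def)

lemma block_sum_add: "block_sum g i (k + l) = block_sum g i k + block_sum g (i + k) l"
  by (induction l) (simp_all add: block_sum_Suc add_ac)

lemma block_sum_mult: "block_sum g i (m * k) = (\<Sum>t<m. block_sum g (i + t * k) k)"
  by (induction m) (simp_all add: block_sum_add add.commute[of k])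

text \<open>A shortest violation has the form \<open>1 w 1\<close> against \<open>0 w 0\<close>,
  with \<open>w\<close> right special. The right special factor one letter longer is
  \<open>c w\<close>, and \<open>c\<close> decides which of the two words must avoid it.\<close>

lemma sturmian_balanced:
  assumes st: "sturmian g"
  shows "block_sum g i k - block_sum g j k \<le> 1"
proof (rule ccontr)
  assume "\<not> ?thesis"
  then have "\<exists>k i j. block_sum g i k - block_sum g j k \<ge> 2"
    by (intro exI[of _ k] exI[of _ i] exI[of _ j]) linarith
  then obtain k where ex: "\<exists>i j. block_sum g i k - block_sum g j k \<ge> 2"
    and less: "\<forall>k'<k. \<not> (\<exists>i j. block_sum g i k' - block_sum g j k' \<ge> 2)"
    using exists_least_iff[of "\<lambda>k. \<exists>i j. block_sum g i k - block_sum g j k \<ge> 2"] by blast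
  have min: "block_sum g x k' - block_sum g y k' \<le> 1" if "k' < k" for k' x y
  proof -
    have "\<not> block_sum g x k' - block_sum g y k' \<ge> 2" using less that by blast
    then show ?thesis by linarith
  qed
  obtain i j where ij: "block_sum g i k - block_sum g j k \<ge> 2" using ex by blast
  \<comment> \<open>Prefix and remaining suffix each differ by at most 1, while together they differ
    by at least 2.\<close>
  have one: "block_sum g i m - block_sum g j m = 1" if "0 < m" "m < k" for m
    using min[of m i j] min[of "k - m" "i + m" "j + m"] ij that
      block_sum_add[of g i m "k - m"] block_sum_add[of g j m "k - m"] by simp
  have let01: "g x = 0 \<or> g x = 1" for x using sturmian_letters[OF st] .
  have "k \<noteq> 0" using ij by (intro notI) simp
  moreover have "k \<noteq> 1"
    using ij let01[of i] let01[of j] by (auto simp: block_sum_def)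
  ultimately have "k = (k - 2) + 2" by simp
  then obtain n where n: "k = n + 2" by blast
  have "g i - g j = 1" using one[of 1] n by (simp add: block_sum_def)
  then have gi: "g i = 1" and gj: "g j = 0" using let01[of i] let01[of j] by auto
  have "g (i + n + 1) - g (j + n + 1) \<ge> 1"
    using ij one[of "n + 1"] n by (simp add: block_sum_Suc add_ac)
  then have gi': "g (i + n + 1) = 1" and gj': "g (j + n + 1) = 0"
    using let01[of "i + n + 1"] let01[of "j + n + 1"] by auto
  have mid: "g (i + 1 + t) = g (j + 1 + t)" if "t < n" for t
    using one[of "t + 1"] one[of "t + 2"] that n by (simp add: block_sum_Suc)
  have minw: "\<exists>t<m. g (x + 1 + t) \<noteq> g (y + 1 + t)"
    if "m < n" "g x = 1" "g (x + m + 1) = 1" "g y = 0" "g (y + m + 1) = 0" for m x y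
  proof (rule ccontr)
    assume "\<not> ?thesis"
    then have "block_sum g (x + 1) m = block_sum g (y + 1) m"
      unfolding block_sum_def by (auto intro: sum.cong)
    then have "block_sum g x (1 + m + 1) - block_sum g y (1 + m + 1) = 2"
      unfolding block_sum_add using that by (simp add: block_sum_def)
    then show False using min[of "1 + m + 1" x y] n that by simp
  qed
  have minw': "\<exists>t<m. g (x + 1 + t) \<noteq> g (y + 1 + t)"
    if "m < n" "g x = 0" "g (x + m + 1) = 0" "g y = 1" "g (y + m + 1) = 1" for m x y
    using minw[OF that(1,4,5,2,3)] by metis
  define w where "w = window g (i + 1) n"
  have w': "w = window g (j + 1) n" unfolding w_def window_eq_iff using mid by simp
  have "w @ [1] = window g (i + 1) (Suc n)" "w @ [0] = window g (j + 1) (Suc n)"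
    using gi' gj' w_def w' by (simp_all add: window_Suc)
  then have wsp: "w \<in> right_special g n"
    unfolding right_special_def by simp
  \<comment> \<open>Dropping the first letter of a right special word leaves a right special word,
    which is \<open>w\<close> by uniqueness.\<close>
  obtain R where R: "R \<in> right_special g (n + 1)"
    using card_right_special[OF st, of "n + 1"] by (metis card_1_singletonE insertI1)
  then obtain x y where xy: "R @ [0] = window g x (Suc (n + 1))" "R @ [1] = window g y (Suc (n + 1))"
    unfolding right_special_def factors_of_length_eq by auto
  then obtain c R' where cR: "R = c # R'" by (cases R) (auto simp: window_Suc')
  have c: "c = g x" and "R' @ [0] = window g (Suc x) (Suc n)" "R' @ [1] = window g (Suc y) (Suc n)"
    using xy unfolding cR by (simp_all add: window_Suc')
  then have "R' \<in> right_special g n" unfolding right_special_def by simp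
  then have "R' = w" using right_special_unique[OF st wsp] by simp
  then have cw: "c # w \<in> right_special g (n + 1)" using R cR by simp
  show False
  proof (cases "c = 0")
    case True
    show False
    proof (rule no_unbalanced_pair_aux[OF st _ gi gi' gj gj'])
      show "0 # window g (i + 1) n \<in> right_special g (n + 1)"
        using cw True by (simp add: w_def)
    qed (fact one_neq_zero mid minw)+
  next
    case False
    then have "c = 1" using let01[of x] c by simp
    show False
    proof (rule no_unbalanced_pair_aux[OF st _ gj gj' gi gi'])
      show "1 # window g (j + 1) n \<in> right_special g (n + 1)"
        using cw \<open>c = 1\<close> by (simp add: w')
    qed (fact zero_neq_one mid[symmetric] minw')+
  qed
qed

section \<open>Density and slope\<close>

lemma block_sum_bounds:
  assumes "sturmian g"
  shows "0 \<le> block_sum g i k" and "block_sum g i k \<le> int k"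
proof -
  have "0 \<le> g x" "g x \<le> 1" for x using sturmian_letters[OF assms, of x] by auto
  then show "0 \<le> block_sum g i k" and "block_sum g i k \<le> int k"
    using sum_bounded_above[of "{..<k}" "\<lambda>t. g (i + t)" 1]
    by (auto simp: block_sum_def intro: sum_nonneg)
qed

text \<open>Cutting a block of length \<open>m * k\<close> into pieces of length \<open>k\<close> or
  of length \<open>m\<close> shows, by balance, that every (block sum - 1) / length is at most every
  (block sum + 1) / length; \<alpha> is the supremum of the former.\<close>

lemma sturmian_density_exists:
  assumes st: "sturmian g"
  shows "\<exists>\<alpha>::real. 0 \<le> \<alpha> \<and> \<alpha> \<le> 1 \<and> (\<forall>i k. \<bar>of_int (block_sum g i k) - of_nat k * \<alpha>\<bar> \<le> 1)"
proof -
  define lo where "lo = (\<lambda>(i, k). (of_int (block_sum g i k) - 1) / real k)"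
  define S where "S = lo ` (UNIV \<times> {k. k \<ge> 1})"
  have cross: "int m * (block_sum g i k - 1) \<le> int k * (block_sum g j m + 1)" for i j k m
  proof -
    have "int m * (block_sum g i k - 1) \<le> block_sum g 0 (m * k)"
      unfolding block_sum_mult
      using sum_bounded_below[of "{..<m}" "block_sum g i k - 1" "\<lambda>t. block_sum g (0 + t * k) k"]
        sturmian_balanced[OF st, of i k] by (simp add: algebra_simps)
    also have "\<dots> = block_sum g 0 (k * m)" by (simp add: mult.commute)
    also have "\<dots> \<le> int k * (block_sum g j m + 1)"
      unfolding block_sum_mult
      using sum_bounded_above[of "{..<k}" "\<lambda>t. block_sum g (0 + t * m) m" "block_sum g j m + 1"]
        sturmian_balanced[OF st, of _ m j] by (simp add: algebra_simps)
    finally show ?thesis .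
  qed
  have up: "x \<le> (of_int (block_sum g j m) + 1) / real m" if xS: "x \<in> S" and m: "m \<ge> 1" for x j m
  proof -
    obtain i k where k: "k \<ge> 1" "x = (of_int (block_sum g i k) - 1) / real k"
      using xS by (auto simp: S_def lo_def)
    have "real_of_int (int m * (block_sum g i k - 1)) \<le> of_int (int k * (block_sum g j m + 1))"
      using cross by (simp only: of_int_le_iff)
    then show ?thesis unfolding k(2) using k(1) m by (simp add: field_simps)
  qed
  have ne: "S \<noteq> {}" by (auto simp: S_def)
  have bdd: "bdd_above S" using up[of _ 1 0] unfolding bdd_above_def by blast
  have "lo (0, 1) \<in> S" by (auto simp: S_def)
  have main: "\<bar>of_int (block_sum g i k) - of_nat k * Sup S\<bar> \<le> 1" for i k
  proof (cases "k \<ge> 1")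
    case True
    have "lo (i, k) \<le> Sup S" using True bdd by (auto simp: S_def intro: cSup_upper)
    moreover have "Sup S \<le> (of_int (block_sum g i k) + 1) / real k"
      using up True ne by (auto intro: cSup_least)
    ultimately show ?thesis using True by (auto simp: lo_def field_simps abs_le_iff)
  qed (use not_less_eq_eq in \<open>auto simp: not_le\<close>)
  have k1: "real k * Sup S \<le> real k + 1" "real k * Sup S \<ge> -1" for k
    using main[of 0 k] block_sum_bounds[OF st, of 0 k] by (simp_all add: abs_le_iff)
  have "Sup S \<le> 1"
  proof (rule ccontr)
    assume "\<not> Sup S \<le> 1"
    then obtain k where "1 < real k * (Sup S - 1)" using ex_less_of_nat_mult[of "Sup S - 1" 1] by auto
    then show False using k1(1)[of k] by (simp add: algebra_simps)
  qed
  moreover have "0 \<le> Sup S"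
  proof (rule ccontr)
    assume "\<not> 0 \<le> Sup S"
    then obtain k where "1 < real k * (- Sup S)" using ex_less_of_nat_mult[of "- Sup S" 1] by auto
    then show False using k1(2)[of k] by simp
  qed
  ultimately show ?thesis using main by blast
qed

text \<open>If \<open>k * \<alpha>\<close> were the integer \<open>a\<close>, the excesses of the
  blocks of length \<open>k\<close> over \<open>a\<close> would have one sign by balance and bounded
  sums along each class modulo \<open>k\<close>. So each class carries at most one nonzero excess,
  and eventually constant block sums force period \<open>k\<close>.\<close>

lemma sturmian_density_irrational:
  fixes a k :: nat
  assumes st: "sturmian g" and dens: "\<And>i k. \<bar>of_int (block_sum g i k) - of_nat k * \<alpha>\<bar> \<le> (1::real)"
    and "k \<ge> 1"
  shows "real k * \<alpha> \<noteq> of_int a"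
proof
  assume ka: "real k * \<alpha> = of_int a"
  define e where "e = (\<lambda>i. block_sum g i k - a)"
  have e_sum: "\<bar>\<Sum>t<m. e (i + t * k)\<bar> \<le> 1" for i m
  proof -
    have "(\<Sum>t<m. e (i + t * k)) = block_sum g i (m * k) - int m * a"
      by (simp add: e_def block_sum_mult sum_subtractf)
    moreover have "real (m * k) * \<alpha> = of_int (int m * a)"
      using ka by (simp add: mult.assoc)
    ultimately have "\<bar>real_of_int (\<Sum>t<m. e (i + t * k))\<bar> \<le> 1"
      using dens[of i "m * k"] by (simp only: of_int_diff)
    then show ?thesis by linarith
  qed
  have e_diff: "e i - e j \<le> 1" for i j
    using sturmian_balanced[OF st, of i k j] by (simp add: e_def)
  obtain s :: int where s: "\<And>i. 0 \<le> s * e i" "s \<in> {-1, 1}"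
  proof (cases "\<exists>i. e i > 0")
    case True
    then obtain i where "e i > 0" by blast
    then have "0 \<le> 1 * e j" for j using e_diff[of i j] by simp
    then show ?thesis using that[of 1] by blast
  next
    case False
    then have "0 \<le> -1 * e j" for j by (simp add: not_less)
    then show ?thesis using that[of "-1"] by blast
  qed
  have once: "e (r + t' * k) = 0" if "t < t'" "e (r + t * k) \<noteq> 0" for r t t'
  proof (rule ccontr)
    assume "e (r + t' * k) \<noteq> 0"
    have pos: "1 \<le> s * e (r + t * k)" "1 \<le> s * e (r + t' * k)"
      using s(1)[of "r + t * k"] s(1)[of "r + t' * k"] s(2) that(2) \<open>e (r + t' * k) \<noteq> 0\<close> by auto
    have "2 \<le> (\<Sum>u\<in>{t, t'}. s * e (r + u * k))" using that pos by simp
    also have "\<dots> \<le> (\<Sum>u<Suc t'. s * e (r + u * k))"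
      by (rule sum_mono2) (use that s in auto)
    also have "\<dots> = s * (\<Sum>u<Suc t'. e (r + u * k))" by (simp only: sum_distrib_left)
    also have "\<dots> \<le> 1" using e_sum[of r "Suc t'"] s(2) by auto
    finally show False by simp
  qed
  have "\<exists>J. \<forall>t\<ge>J. e (r + t * k) = 0" for r
    using once[of _ _ r] by (metis Suc_le_lessD)
  then obtain J where J: "\<And>r t. t \<ge> J r \<Longrightarrow> e (r + t * k) = 0" by metis
  define M where "M = Max (J ` {..<k})"
  have zero: "e i = 0" if "i \<ge> M * k" for i
  proof -
    have "J (i mod k) \<le> M" unfolding M_def using \<open>k \<ge> 1\<close> by (intro Max_ge) auto
    also have "M \<le> i div k" using that \<open>k \<ge> 1\<close> by (simp add: less_eq_div_iff_mult_less_eq)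
    finally show ?thesis using J[of "i mod k" "i div k"] by simp
  qed
  have "g (i + k) = g i" if "i \<ge> M * k" for i
  proof -
    have "block_sum g i (Suc k) = block_sum g i 1 + block_sum g (i + 1) k"
      using block_sum_add[of g i 1 k] by simp
    moreover have "block_sum g (i + 1) k = block_sum g i k"
      using zero[of i] zero[of "i + 1"] that by (simp add: e_def)
    ultimately show ?thesis by (simp add: block_sum_Suc block_sum_def[of g i "Suc 0"])
  qed
  then show False using sturmian_not_eventually_periodic[OF st \<open>k \<ge> 1\<close>] by blast
qed

section \<open>The slope in terms of the density of ones\<close>

lemma count_list_window:
  assumes "sturmian g"
  shows "int (count_list (window g i k) 1) = block_sum g i k"
    and "int (count_list (window g i k) 0) = int k - block_sum g i k"
proof (induction k)
  case 0
  { case 1 show ?case by (simp add: window_def) next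
    case 2 show ?case by (simp add: window_def) }
next
  case (Suc k)
  { case 1 show ?case using Suc sturmian_letters[OF assms, of "i + k"]
      by (auto simp: window_Suc block_sum_Suc) next
    case 2 show ?case using Suc sturmian_letters[OF assms, of "i + k"]
      by (auto simp: window_Suc block_sum_Suc) }
qed

lemma slope_eq:
  assumes st: "sturmian g" and dens: "\<And>i k. \<bar>of_int (block_sum g i k) - of_nat k * \<alpha>\<bar> \<le> (1::real)"
    and "\<alpha> \<noteq> 1"
  shows "slope g = \<alpha> / (1 - \<alpha>)"
proof -
  let ?F = "inf (filtercomap length at_top) (principal (factors g))"
  \<comment> \<open>\<open>Lim\<close> is determined only along a nontrivial filter; this one is
    nontrivial because factors of every length exist.\<close>
  have nt: "?F \<noteq> bot"
  proof
    assume "?F = bot"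
    then have "eventually (\<lambda>u. u \<notin> factors g) (filtercomap length at_top)"
      by (simp add: trivial_limit_def eventually_inf_principal)
    then obtain M where "\<And>u. length u \<ge> M \<Longrightarrow> u \<notin> factors g"
      by (auto simp: eventually_filtercomap eventually_at_top_linorder)
    moreover have "window g 0 M \<in> factors g" unfolding factors_def window_def by blast
    ultimately show False by (metis length_window order_refl)
  qed
  have len: "filterlim (\<lambda>u. real (length u)) at_top ?F"
    by (rule filterlim_compose[OF filterlim_real_sequentially])
      (rule filterlim_mono[OF filterlim_filtercomap order_refl], simp)
  have win: "\<exists>i k. u = window g i k" if "u \<in> factors g" for u
    using that by (auto simp: factors_def window_def)
  define x :: "int list \<Rightarrow> real" where "x = (\<lambda>u. real (count_list u 1) / real (length u))"
  have inv: "((\<lambda>u. 1 / real (length u)) \<longlongrightarrow> 0) ?F"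
    by (rule tendsto_divide_0[OF tendsto_const filterlim_at_top_imp_at_infinity[OF len]])
  have ev: "\<forall>\<^sub>F u in ?F. u \<in> factors g \<and> length u \<ge> 1"
  proof -
    have "\<forall>\<^sub>F u in ?F. real (length u) \<ge> 1" using len unfolding filterlim_at_top by blast
    moreover have "\<forall>\<^sub>F u in ?F. u \<in> factors g" by (simp add: eventually_inf_principal)
    ultimately show ?thesis by eventually_elim auto
  qed
  have "((\<lambda>u. x u - \<alpha>) \<longlongrightarrow> 0) ?F"
  proof (rule tendsto_0_le[OF inv, of _ 1], use ev in eventually_elim)
    case (elim u)
    then obtain i k where u: "u = window g i k" "k \<ge> 1" using win[of u] by fastforce
    have "real (count_list u 1) = of_int (block_sum g i k)"
      using count_list_window(1)[OF st, of i k] u by (metis of_int_of_nat_eq)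
    then have "norm (x u - \<alpha>) = \<bar>of_int (block_sum g i k) - real k * \<alpha>\<bar> / real k"
      using u by (simp add: x_def divide_simps abs_if) (auto simp: field_simps)
    also have "\<dots> \<le> 1 / real k" using dens[of i k] u(2) by (intro divide_right_mono) auto
    finally show ?case using u by simp
  qed
  then have lim: "(x \<longlongrightarrow> \<alpha>) ?F" by (simp add: LIM_zero_cancel)
  have "((\<lambda>u. x u / (1 - x u)) \<longlongrightarrow> \<alpha> / (1 - \<alpha>)) ?F"
    by (intro tendsto_intros lim) (use \<open>\<alpha> \<noteq> 1\<close> in auto)
  moreover have "\<forall>\<^sub>F u in ?F. x u / (1 - x u) = real (count_list u 1) / real (count_list u 0)"
    using ev
  proof eventually_elim
    case (elim u)
    then obtain i k where u: "u = window g i k" "k \<ge> 1" using win by fastforce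
    have "int (count_list u 0) = int k - int (count_list u 1)"
      using count_list_window[OF st, of i k] u by simp
    then have "real (count_list u 0) = real k - real (count_list u 1)" by linarith
    then show ?case using u by (simp add: x_def divide_simps)
  qed
  ultimately have "((\<lambda>u. real (count_list u 1) / real (count_list u 0)) \<longlongrightarrow> \<alpha> / (1 - \<alpha>)) ?F"
    by (rule Lim_transform_eventually)
  then show ?thesis unfolding slope_def by (rule tendsto_Lim[OF nt])
qed

section \<open>Factors as mechanical words\<close>

text \<open>Cross multiplication replaces fractions because the right end starts as
  \<open>1 / 0\<close>. By irrationality \<open>s\<close> never hits a mediant, which keeps both
  inequalities strict.\<close>

lemma stern_brocot_interval_invariant:
  assumes "s > 0" and irr: "\<And>a b :: nat. b \<ge> 1 \<Longrightarrow> s * real b \<noteq> real a"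
    and "stern_brocot_interval s k = ((l1, l2), (r1, r2))"
  shows "r1 * l2 = l1 * r2 + 1 \<and> l2 \<ge> 1 \<and> real l1 < s * real l2 \<and> s * real r2 < real r1"
  using assms(3)
proof (induction k arbitrary: l1 l2 r1 r2)
  case 0
  then show ?case using \<open>s > 0\<close> by auto
next
  case (Suc k)
  obtain a b c d where I: "stern_brocot_interval s k = ((a, b), (c, d))"
    by (metis prod.exhaust)
  note IH = Suc.IH[OF I]
  have ne: "s * real (b + d) \<noteq> real (a + c)" using irr[of "b + d" "a + c"] IH by linarith
  show ?case
  proof (cases "s < real (a + c) / real (b + d)")
    case True
    then have "l1 = a" "l2 = b" "r1 = a + c" "r2 = b + d"
      using Suc.prems I by (auto simp: Let_def mediant_def)
    moreover have "s * real (b + d) < real (a + c)"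
      using True IH by (simp add: field_simps)
    ultimately show ?thesis using IH by (auto simp: algebra_simps)
  next
    case False
    then have "l1 = a + c" "l2 = b + d" "r1 = c" "r2 = d"
      using Suc.prems I by (auto simp: Let_def mediant_def)
    moreover have "real (a + c) < s * real (b + d)"
      using False IH ne by (simp add: field_simps)
    ultimately show ?thesis using IH by (auto simp: algebra_simps)
  qed
qed

text \<open>Here \<open>j / k\<close> lies strictly between the neighbours \<open>l1 / L\<close> and
  \<open>r1 / R\<close>: the integers \<open>k * r1 - j * R\<close> and
  \<open>j * L - k * l1\<close> are at least 1, and weighted with \<open>L\<close> and
  \<open>R\<close> they add up to \<open>k\<close>.\<close>

lemma farey_denominator_bound:
  fixes j k l1 L r1 R :: int
  assumes det: "r1 * L = l1 * R + 1" and "L \<ge> 0" "R \<ge> 0" and lo: "k * l1 < j * L" and hi: "j * R < k * r1"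
  shows "L + R \<le> k"
proof -
  have "L * 1 + R * 1 \<le> L * (k * r1 - j * R) + R * (j * L - k * l1)"
    using assms by (intro add_mono mult_left_mono) auto
  also have "\<dots> = k * (r1 * L - l1 * R)" by (simp add: algebra_simps)
  finally show ?thesis using det by simp
qed

text \<open>If the block sum missed its target by a full unit, moving it one unit towards the
  mediant would give an integer \<open>j\<close> with \<open>j / k\<close> between the mediant and
  \<alpha>, hence strictly inside the interval although \<open>k < L + R\<close>.\<close>

lemma block_sum_close_to_mediant:
  assumes irr: "\<And>a :: int. real k * \<alpha> \<noteq> of_int a"
    and dens: "\<bar>of_int (block_sum g i k) - real k * \<alpha>\<bar> \<le> 1"
    and det: "r1 * L = l1 * R + 1" and "L \<ge> 1" "R \<ge> 1"
    and lo: "of_int l1 < \<alpha> * of_int L" and hi: "\<alpha> * of_int R < of_int r1"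
    and k: "0 < k" "int k < L + R"
  shows "\<bar>(L + R) * block_sum g i k - int k * (l1 + r1)\<bar> < L + R"
proof (rule ccontr)
  let ?S = "block_sum g i k"
  assume "\<not> ?thesis"
  then consider "(L + R) * ?S - int k * (l1 + r1) \<ge> L + R" | "(L + R) * ?S - int k * (l1 + r1) \<le> - (L + R)"
    by linarith
  then show False
  proof cases
    case 1
    define j where "j = ?S - 1"
    have N: "(L + R) * j \<ge> int k * (l1 + r1)" using 1 by (simp add: j_def algebra_simps)
    have "of_int j < real k * \<alpha>" using dens irr[of j] unfolding j_def by linarith
    then have "of_int j * of_int R < real k * \<alpha> * of_int R" using \<open>R \<ge> 1\<close> by simp
    also have "\<dots> \<le> real k * of_int r1" using hi k by (simp add: mult.assoc)
    finally have "of_int (j * R) < real_of_int (int k * r1)" by simp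
    then have jR: "j * R < int k * r1" by (simp only: of_int_less_iff)
    have "int k * l1 < j * L" using N jR by (simp add: algebra_simps)
    then show False using farey_denominator_bound[OF det _ _ _ jR] k \<open>L \<ge> 1\<close> \<open>R \<ge> 1\<close> by simp
  next
    case 2
    define j where "j = ?S + 1"
    have N: "(L + R) * j \<le> int k * (l1 + r1)" using 2 by (simp add: j_def algebra_simps)
    have j: "real k * \<alpha> < of_int j" using dens irr[of j] unfolding j_def by linarith
    have "real k * of_int l1 \<le> real k * \<alpha> * of_int L" using lo k by (simp add: mult.assoc)
    also have "\<dots> < of_int j * of_int L" using j \<open>L \<ge> 1\<close> by simp
    finally have "of_int (int k * l1) < real_of_int (j * L)" by simp
    then have jL: "int k * l1 < j * L" by (simp only: of_int_less_iff)
    have "j * R < int k * r1" using N jL by (simp add: algebra_simps)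
    then show False using farey_denominator_bound[OF det _ _ jL] k \<open>L \<ge> 1\<close> \<open>R \<ge> 1\<close> by simp
  qed
qed

text \<open>Slope \<open>a / N\<close> and intercept \<open>\<rho> / N\<close>, with the common
  denominator cleared so that floors become \<open>div\<close>.\<close>

definition mechanical_word :: "nat \<Rightarrow> nat \<Rightarrow> nat \<Rightarrow> nat \<Rightarrow> int list" where
  "mechanical_word a N \<rho> m =
     map (\<lambda>j. int ((Suc j * a + \<rho>) div N) - int ((j * a + \<rho>) div N)) [0..<m]"

lemma length_mechanical_word [simp]: "length (mechanical_word a N \<rho> m) = m"
  by (simp add: mechanical_word_def)

lemma nth_mechanical_word:
  "j < m \<Longrightarrow> mechanical_word a N \<rho> m ! j = int ((Suc j * a + \<rho>) div N) - int ((j * a + \<rho>) div N)"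
  by (simp add: mechanical_word_def)

text \<open>The deviations \<open>j a - N P\<^sub>j\<close> of the partial sums differ by less than \<open>N\<close>, so shifting by their
  minimum turns each of them into a remainder modulo \<open>N\<close>.\<close>

lemma window_mechanical:
  assumes "N \<ge> 1"
    and close: "\<And>i k. 0 < k \<Longrightarrow> k < N \<Longrightarrow> \<bar>int N * block_sum g i k - int k * int a\<bar> < int N"
  shows "\<exists>\<rho><N. window g i (N - 1) = mechanical_word a N \<rho> (N - 1)"
proof -
  define P where "P = block_sum g i"
  define r where "r = (\<lambda>j. int j * int a - int N * P j)"
  have diff1: "\<bar>r j - r j'\<bar> < int N" if "j < j'" "j' < N" for j j'
  proof -
    have "P j' = P j + block_sum g (i + j) (j' - j)"
      unfolding P_def using block_sum_add[of g i j "j' - j"] that by simp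
    then have "r j - r j' = int N * block_sum g (i + j) (j' - j) - int (j' - j) * int a"
      using that by (simp add: r_def of_nat_diff algebra_simps)
    then show ?thesis using close[of "j' - j" "i + j"] that by simp
  qed
  then have diff: "\<bar>r j - r j'\<bar> < int N" if "j < N" "j' < N" for j j'
    using that \<open>N \<ge> 1\<close> diff1[of j j'] diff1[of j' j] abs_minus_commute[of "r j" "r j'"]
    by (cases j j' rule: linorder_cases) auto
  define c where "c = Min (r ` {..<N})"
  have "c \<in> r ` {..<N}" unfolding c_def using \<open>N \<ge> 1\<close> by (intro Min_in) (auto simp: lessThan_empty_iff)
  then obtain j0 where j0: "j0 < N" "c = r j0" by auto
  have c_le: "c \<le> r j" if "j < N" for j unfolding c_def using that by simp
  have "r 0 = 0" by (simp add: r_def P_def)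
  then have "c \<le> 0" "- c < int N" using c_le[of 0] diff[of j0 0] j0 \<open>N \<ge> 1\<close> by auto
  define \<rho> where "\<rho> = nat (- c)"
  have "\<rho> < N" using \<open>- c < int N\<close> \<open>N \<ge> 1\<close> by (simp add: \<rho>_def)
  have PN: "P j = int ((j * a + \<rho>) div N)" if "j < N" for j
  proof -
    have "int j * int a - c = r j - c + int N * P j" by (simp add: r_def)
    then have "(int j * int a - c) div int N = P j"
      using c_le[OF that] diff[OF that j0(1)] j0(2)
      by (intro int_div_pos_eq[of _ _ _ "r j - c"]) (auto simp: mult.commute)
    moreover have "int (j * a + \<rho>) = int j * int a - c" using \<open>c \<le> 0\<close> by (simp add: \<rho>_def)
    ultimately show ?thesis by (simp only: of_nat_div)
  qed
  have "window g i (N - 1) = mechanical_word a N \<rho> (N - 1)"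
  proof (rule nth_equalityI)
    fix t assume "t < length (window g i (N - 1))"
    then have t: "t < N - 1" by simp
    have "g (i + t) = P (Suc t) - P t" by (simp add: P_def block_sum_Suc)
    then show "window g i (N - 1) ! t = mechanical_word a N \<rho> (N - 1) ! t"
      using t PN[of t] PN[of "Suc t"] by (simp add: nth_mechanical_word)
  qed simp
  then show ?thesis using \<open>\<rho> < N\<close> by blast
qed

text \<open>All \<open>N\<close> factors of length \<open>N - 1\<close> are among at most
  \<open>N\<close> mechanical words, so no mechanical word is missing; shorter ones are
  prefixes.\<close>

lemma mechanical_word_factor:
  assumes st: "sturmian g" and "N \<ge> 1"
    and close: "\<And>i k. 0 < k \<Longrightarrow> k < N \<Longrightarrow> \<bar>int N * block_sum g i k - int k * int a\<bar> < int N"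
    and "\<rho> < N" and "n \<le> N - 1"
  shows "mechanical_word a N \<rho> n \<in> factors_of_length g n"
proof -
  let ?U = "(\<lambda>\<rho>. mechanical_word a N \<rho> (N - 1)) ` {..<N}"
  have sub: "factors_of_length g (N - 1) \<subseteq> ?U"
    using window_mechanical[OF \<open>N \<ge> 1\<close> close] by (auto simp: factors_of_length_eq image_iff)
  have "card (factors_of_length g (N - 1)) = N"
    using sturmian_card[OF st] \<open>N \<ge> 1\<close> by simp
  moreover have "card ?U \<le> N" using card_image_le[of "{..<N}"] by fastforce
  ultimately have "factors_of_length g (N - 1) = ?U"
    using card_subset_eq[OF _ sub] card_mono[OF _ sub] by fastforce
  then obtain i where i: "mechanical_word a N \<rho> (N - 1) = window g i (N - 1)"
    using \<open>\<rho> < N\<close> by (auto simp: factors_of_length_eq)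
  have "mechanical_word a N \<rho> n = window g i n"
  proof (rule nth_equalityI)
    fix t assume "t < length (mechanical_word a N \<rho> n)"
    then have "t < n" "t < N - 1" using \<open>n \<le> N - 1\<close> by auto
    then show "mechanical_word a N \<rho> n ! t = window g i n ! t"
      using arg_cong[OF i, of "\<lambda>u. u ! t"] by (simp add: nth_mechanical_word)
  qed simp
  then show ?thesis by simp
qed

section \<open>Standard factorizations\<close>

lemma count_list_binary:
  assumes "set xs \<subseteq> {0, 1 :: int}"
  shows "count_list xs 0 + count_list xs 1 = length xs"
  using assms by (induction xs) auto

lemma length_christoffel_word [simp]: "length (christoffel_word x y p q) = p + q"
  by (simp add: christoffel_word_def)

lemma set_christoffel_word: "set (christoffel_word x y p q) \<subseteq> {x, y}"
  by (auto simp: christoffel_word_def)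

lemma count_list_take_christoffel_word:
  "j \<le> p + q \<Longrightarrow> count_list (take j (christoffel_word 0 1 p q :: int list)) 1 = j * q div (p + q)"
proof (induction j)
  case (Suc j)
  have "Suc j * q div (p + q) \<le> (j * q + (p + q)) div (p + q)"
    by (rule div_le_mono) simp
  also have "\<dots> = j * q div (p + q) + 1" using Suc.prems by (intro div_add_self2) presburger
  finally have "Suc j * q div (p + q) \<le> j * q div (p + q) + 1" .
  moreover have "j * q div (p + q) \<le> Suc j * q div (p + q)"
    by (rule div_le_mono) simp
  ultimately show ?case using Suc
    by (auto simp: take_Suc_conv_app_nth christoffel_word_def)
qed simp

lemma count_list_christoffel_word:
  assumes "p + q \<ge> 1"
  shows "count_list (christoffel_word 0 1 p q :: int list) 1 = q"
    and "count_list (christoffel_word 0 1 p q :: int list) 0 = p"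
proof -
  show one: "count_list (christoffel_word 0 1 p q :: int list) 1 = q"
    using count_list_take_christoffel_word[of "p + q" p q] assms by simp
  show "count_list (christoffel_word 0 1 p q :: int list) 0 = p"
    using count_list_binary[OF set_christoffel_word, of p q] one by simp
qed

lemma coprime_multiplier:
  fixes a N :: nat
  assumes "coprime a N" and "N \<ge> 2"
  obtains j m where "0 < j" "j < N" "j * a = N * m + 1"
proof -
  obtain x where "[a * x = 1] (mod N)" using cong_solve_coprime_nat[OF assms(1)] by auto
  then have x: "(x mod N) * a mod N = 1"
    using \<open>N \<ge> 2\<close> by (simp add: cong_def mult.commute[of _ a] mod_mult_right_eq)
  show ?thesis
  proof
    show "x mod N < N" using \<open>N \<ge> 2\<close> by simp
    show "0 < x mod N" using x by (cases "x mod N") auto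
    show "(x mod N) * a = N * ((x mod N) * a div N) + 1" using x by (metis mult_div_mod_eq)
  qed
qed

text \<open>The floor conditions keep the lattice point \<open>(j, m)\<close> closest to the long side of the triangle from
  lying above the short sides. This forces it to divide one of them into \<open>d\<close> parts, where \<open>d\<close> is the
  determinant, and primitivity of that side gives \<open>d = 1\<close>.\<close>

lemma standard_factorization_unimodular:
  fixes k k' b b' :: nat
  defines "N \<equiv> k + k'" and "a \<equiv> b + b'"
  assumes cop: "coprime a N" "coprime k b" "coprime k' b'" and pos: "k \<ge> 1" "k' \<ge> 1"
    and pre: "\<And>j. j \<le> k \<Longrightarrow> j * a div N = j * b div k"
    and suf: "\<And>j. j \<le> k' \<Longrightarrow> (k + j) * a div N = b + j * b' div k'"
  shows "k * b' = k' * b + 1"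
proof -
  have "N \<ge> 2" using pos by (simp add: N_def)
  then obtain j m where j: "0 < j" "j < N" and jm: "j * a = N * m + 1"
    using coprime_multiplier[OF cop(1)] by metis
  have jmdiv: "j * a div N = m" unfolding jm using \<open>N \<ge> 2\<close> div_mult_self4[of N m 1] by simp
  have "k * a div N = b" using pre[of k] pos by simp
  then have ka: "k * a = N * b + k * a mod N" by (metis mult_div_mod_eq)
  define d where "d = int k * int b' - int k' * int b"
  have "int k * int a = int N * int b + int (k * a mod N)" using ka by (metis of_nat_add of_nat_mult)
  then have d_mod: "d = int (k * a mod N)" by (simp add: d_def N_def a_def algebra_simps)
  have "k * a mod N \<noteq> 0"
  proof
    assume "k * a mod N = 0"
    then have "N dvd k * a" by auto
    then have "N dvd k" using cop(1) by (simp add: coprime_commute coprime_dvd_mult_left_iff)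
    then show False using pos by (auto simp: N_def dest: dvd_imp_le)
  qed
  then have "d \<ge> 1" using d_mod by simp
  \<comment> \<open>This is \<open>N\<close> times the determinant of \<open>(k, b)\<close> and
    \<open>(j, m)\<close>; in each case a floor condition bounds it on one side and a comparison of
    sizes on the other.\<close>
  have I: "int N * (int k * int m - int j * int b) = int j * d - int k"
  proof -
    have e: "int j * int a = int N * int m + 1" using jm by (metis of_nat_1 of_nat_add of_nat_mult)
    have "int j * d = int j * (int k * int a - int N * int b)"
      by (simp add: d_def N_def a_def algebra_simps)
    also have "\<dots> = int k * (int j * int a) - int N * int j * int b" by (simp add: algebra_simps)
    finally show ?thesis unfolding e by (simp add: algebra_simps)
  qed
  have "d = 1"
  proof (cases "j \<le> k")
    case True
    have "m * k \<le> j * b" using pre[OF True] jmdiv by (metis div_times_less_eq_dividend)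
    then have "int m * int k \<le> int j * int b" by (metis of_nat_le_iff of_nat_mult)
    define e where "e = int j * int b - int k * int m"
    have e: "e \<ge> 0" "int k - int j * d = int N * e"
      using \<open>int m * int k \<le> int j * int b\<close> I by (simp_all add: e_def algebra_simps)
    have "0 \<le> int j * d" using \<open>d \<ge> 1\<close> by simp
    then have "int k - int j * d < int N" using pos by (simp add: N_def)
    then have "int N * e < int N * 1" using e by simp
    then have "e = 0" using e(1) mult_less_cancel_left_pos[of "int N" e 1] \<open>N \<ge> 2\<close> by simp
    then have k: "int k = int j * d" and eq: "int j * int b = int k * int m"
      using e by (simp_all add: e_def)
    then have "int j * int b = int j * (d * int m)" by simp
    then have "int b = d * int m" using j by simp
    then have "d dvd int k" "d dvd int b" using k by simp_all
    then show ?thesis using cop(2) \<open>d \<ge> 1\<close>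
      by (metis coprime_common_divisor coprime_int_iff zdvd1_eq abs_of_nonneg order_trans zero_le_one)
  next
    case False
    then have "j - k \<le> k'" using j by (simp add: N_def)
    then have "m = b + (j - k) * b' div k'" using suf[of "j - k"] jmdiv False by simp
    then have "(m - b) * k' \<le> (j - k) * b'" "b \<le> m" by simp_all
    then have "int ((m - b) * k') \<le> int ((j - k) * b')" by (simp only: of_nat_le_iff)
    then have le: "(int m - int b) * int k' \<le> (int j - int k) * int b'"
      using False \<open>b \<le> m\<close> by (simp add: of_nat_diff)
    have e1: "int j * int a = int N * int m + 1" using jm by (metis of_nat_1 of_nat_add of_nat_mult)
    define e where "e = int k * int m - int j * int b - (d - 1)"
    have "(int j - int k) * int b' - (int m - int b) * int k'
      = (int j * int a - int N * int m) - d + int k * int m - int j * int b"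
      by (simp add: d_def N_def a_def algebra_simps)
    then have "e \<ge> 0" using le e1 by (simp add: e_def)
    have e2: "int N * e = int k' - d * (int N - int j)"
      unfolding e_def using I by (simp add: algebra_simps N_def)
    have "d * (int N - int j) > 0" using \<open>d \<ge> 1\<close> j by simp
    then have "int N * e < int N * 1" using e2 pos by (simp add: N_def)
    then have "e = 0" using \<open>e \<ge> 0\<close> mult_less_cancel_left_pos[of "int N" e 1] \<open>N \<ge> 2\<close> by simp
    then have k': "int k' = d * (int N - int j)" using e2 by simp
    have "int N * int b' = int k' * int a + d" by (simp add: d_def N_def a_def algebra_simps)
    also have "\<dots> = d * (int N * int a - int j * int a + 1)" unfolding k' by (simp add: algebra_simps)
    also have "\<dots> = int N * (d * (int a - int m))" unfolding e1 by (simp add: algebra_simps)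
    finally have "int b' = d * (int a - int m)" using \<open>N \<ge> 2\<close> by simp
    then have "d dvd int k'" "d dvd int b'" using k' by simp_all
    then show ?thesis using cop(3) \<open>d \<ge> 1\<close>
      by (metis coprime_common_divisor coprime_int_iff zdvd1_eq abs_of_nonneg order_trans zero_le_one)
  qed
  then have "int (k * b') = int (k' * b + 1)" by (simp add: d_def)
  then show ?thesis by (simp only: of_nat_eq_iff)
qed

text \<open>Counting ones in prefixes of \<open>w = w' @ w''\<close> turns the factorization into
  the floor conditions of \<open>standard_factorization_unimodular\<close>.\<close>

lemma standard_factorization_parameters:
  assumes cop: "coprime p a" and w: "w = christoffel_word 0 1 p a" and fac: "standard_factorization w w' w''"
  defines "k \<equiv> length w'" and "k' \<equiv> length w''"
    and "b \<equiv> count_list w' (1::int)" and "b' \<equiv> count_list w'' (1::int)"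
  shows "k + k' = p + a" and "b + b' = a" and "k * b' = k' * b + 1" and "k \<ge> 1" and "k' \<ge> 1"
    and "coprime k b"
proof -
  obtain p1 q1 p2 q2 where 1: "coprime p1 q1" "w' = christoffel_word 0 1 p1 q1"
    and 2: "coprime p2 q2" "w'' = christoffel_word 0 1 p2 q2" and app: "w = w' @ w''"
    using fac by (auto simp: standard_factorization_def lower_christoffel_def)
  have pos: "p + a \<ge> 1" "p1 + q1 \<ge> 1" "p2 + q2 \<ge> 1"
    using cop 1(1) 2(1) by (auto simp: Suc_le_eq intro!: Nat.gr0I)
  have k: "k = p1 + q1" "b = q1" "k' = p2 + q2" "b' = q2"
    using 1(2) 2(2) pos by (simp_all add: k_def b_def k'_def b'_def count_list_christoffel_word)
  show kk: "k + k' = p + a" using arg_cong[OF app, of length] w by (simp add: k_def k'_def)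
  show bb: "b + b' = a"
    using arg_cong[OF app, of "\<lambda>u. count_list u 1"] w pos(1)
    by (simp add: b_def b'_def count_list_christoffel_word)
  show "k \<ge> 1" "k' \<ge> 1" using k pos by simp_all
  show cop1: "coprime k b" using 1(1) k by (simp add: coprime_iff_gcd_eq_1)
  have cop2: "coprime k' b'" using 2(1) k by (simp add: coprime_iff_gcd_eq_1)
  show "k * b' = k' * b + 1"
  proof (rule standard_factorization_unimodular)
    show "coprime (b + b') (k + k')"
      unfolding kk bb using cop by (metis add.commute coprime_commute gcd_add2 coprime_iff_gcd_eq_1)
    show "j * (b + b') div (k + k') = j * b div k" if "j \<le> k" for j
    proof -
      have "take j w = take j w'" using that app by (simp add: k_def)
      then show ?thesis
        using count_list_take_christoffel_word[of j p a] count_list_take_christoffel_word[of j p1 q1]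
          that kk bb k w 1(2) by simp
    qed
    show "(k + j) * (b + b') div (k + k') = b + j * b' div k'" if "j \<le> k'" for j
    proof -
      have "take (k + j) w = w' @ take j w''" using app by (simp add: k_def)
      then have "count_list (take (k + j) w) 1 = b + count_list (take j w'') 1"
        by (simp add: b_def)
      then show ?thesis
        using count_list_take_christoffel_word[of "k + j" p a] count_list_take_christoffel_word[of j p2 q2]
          that kk bb k w 2(2) by simp
    qed
  qed (use cop1 cop2 \<open>k \<ge> 1\<close> \<open>k' \<ge> 1\<close> in auto)
qed

section \<open>Ordering the multiples modulo the length\<close>

text \<open>Since \<open>v\<close> increases along \<open>\<sigma>\<close> except on returning to 0, every orbit reaches 0.\<close>

lemma increasing_cycle:
  fixes v :: "nat \<Rightarrow> nat"
  assumes closed: "\<And>j. j \<le> n \<Longrightarrow> \<sigma> j \<le> n" and inj: "inj_on \<sigma> {..n}"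
    and inc: "\<And>j. j \<le> n \<Longrightarrow> \<sigma> j \<noteq> 0 \<Longrightarrow> v j < v (\<sigma> j)"
  shows "bij_betw (\<lambda>r. (\<sigma> ^^ r) 0) {..n} {..n}"
    and "(\<sigma> ^^ Suc n) 0 = 0"
    and "\<And>r s. r < s \<Longrightarrow> s \<le> n \<Longrightarrow> v ((\<sigma> ^^ r) 0) < v ((\<sigma> ^^ s) 0)"
proof -
  define J where "J = (\<lambda>r. (\<sigma> ^^ r) 0)"
  have J0: "J 0 = 0" and JS: "J (Suc r) = \<sigma> (J r)" for r by (simp_all add: J_def)
  have J_le: "J r \<le> n" for r by (induction r) (simp_all add: J0 JS closed)
  have hit: "\<exists>m. (\<sigma> ^^ m) j = 0" if "j \<le> n" for j
    using that
  proof (induction "Max (v ` {..n}) - v j" arbitrary: j rule: less_induct)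
    case less
    show ?case
    proof (cases "\<sigma> j = 0")
      case True
      then show ?thesis by (intro exI[of _ 1]) simp
    next
      case False
      have "v (\<sigma> j) \<le> Max (v ` {..n})" using closed[OF less.prems] by simp
      then have "Max (v ` {..n}) - v (\<sigma> j) < Max (v ` {..n}) - v j"
        using inc[OF less.prems False] by linarith
      then obtain m where "(\<sigma> ^^ m) (\<sigma> j) = 0"
        using less.hyps closed[OF less.prems] by blast
      then have "(\<sigma> ^^ Suc m) j = 0" by (simp add: funpow_swap1)
      then show ?thesis by blast
    qed
  qed
  obtain m where "(\<sigma> ^^ m) (\<sigma> 0) = 0" using hit[OF closed[of 0]] by auto
  then have ex: "J (Suc m) = 0" by (simp add: J_def funpow_swap1)
  define p where "p = (LEAST q. J (Suc q) = 0)"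
  have Jp: "J (Suc p) = 0" unfolding p_def using ex by (rule LeastI)
  have J_ne: "J (Suc r) \<noteq> 0" if "r < p" for r using that not_less_Least unfolding p_def by blast
  have mono: "v (J r) < v (J s)" if "r < s" "s \<le> p" for r s
    using that
  proof (induction s)
    case (Suc s)
    have "v (J s) < v (J (Suc s))" using inc[OF J_le, of s] J_ne[of s] Suc.prems by (simp add: JS)
    then show ?case using Suc by (cases "r = s") auto
  qed simp
  have injJ: "inj_on J {..p}"
    by (rule inj_onI) (metis atMost_iff less_irrefl linorder_neqE_nat mono)
  have surj: "j \<in> J ` {..p}" if "(\<sigma> ^^ m) j = 0" "j \<le> n" for m j
    using that
  proof (induction m arbitrary: j)
    case 0
    then show ?case using J0 by (metis atMost_iff funpow_0 image_eqI le0)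
  next
    case (Suc m)
    have "(\<sigma> ^^ m) (\<sigma> j) = 0" using Suc.prems(1) by (simp add: funpow_swap1)
    then obtain r where r: "r \<le> p" "\<sigma> j = J r" using Suc.IH closed[OF Suc.prems(2)] by auto
    \<comment> \<open>By injectivity \<open>j\<close> must be the orbit predecessor of
      \<open>J r\<close>; for \<open>r = 0\<close> this is \<open>J p\<close>, where the orbit
      closes.\<close>
    obtain r' where "r' \<le> p" "\<sigma> j = \<sigma> (J r')"
    proof (cases r)
      case 0
      then show ?thesis using that[of p] r Jp J0 JS by simp
    next
      case (Suc r')
      then show ?thesis using that[of r'] r JS by simp
    qed
    then have "j = J r'" using inj_onD[OF inj] Suc.prems(2) J_le by simp
    then show ?case using \<open>r' \<le> p\<close> by simp
  qed
  have "{..n} \<subseteq> J ` {..p}" by (meson atMost_iff subsetI hit surj)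
  then have img: "J ` {..p} = {..n}" using J_le by auto
  then have "p = n" using card_image[OF injJ] by simp
  then show "bij_betw (\<lambda>r. (\<sigma> ^^ r) 0) {..n} {..n}" "(\<sigma> ^^ Suc n) 0 = 0"
    "\<And>r s. r < s \<Longrightarrow> s \<le> n \<Longrightarrow> v ((\<sigma> ^^ r) 0) < v ((\<sigma> ^^ s) 0)"
    using injJ img Jp mono unfolding J_def bij_betw_def by blast+
qed

lemma list_less_by_partial_sums:
  fixes xs ys :: "int list"
  assumes "length xs = length ys" and "\<And>j. j \<le> length xs \<Longrightarrow> sum_list (take j xs) \<le> sum_list (take j ys)"
    and "xs \<noteq> ys"
  shows "xs < ys"
  using assms
proof (induction xs ys rule: list_induct2)
  case (Cons x xs y ys)
  have "x \<le> y" using Cons.prems(1)[of 1] by simp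
  show ?case
  proof (cases "x = y")
    case True
    have "sum_list (take j xs) \<le> sum_list (take j ys)" if "j \<le> length xs" for j
      using Cons.prems(1)[of "Suc j"] that True by simp
    then show ?thesis using Cons.IH Cons.prems(2) True by simp
  qed (use \<open>x \<le> y\<close> in simp)
qed simp

lemma sum_list_take_mechanical_word:
  "j \<le> m \<Longrightarrow> sum_list (take j (mechanical_word a N \<rho> m)) = int ((j * a + \<rho>) div N) - int (\<rho> div N)"
  by (induction j) (simp_all add: take_Suc_conv_app_nth nth_mechanical_word)

text \<open>\<open>k, b\<close> and \<open>k', b'\<close> are the length and the number of ones of \<open>w'\<close> and \<open>w''\<close>.\<close>

locale christoffel_pair =
  fixes N a k k' b b' i n :: nat
  assumes length_sum: "k + k' = N" and ones_sum: "b + b' = a" and unimodular: "k * b' = k' * b + 1"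
    and i_less: "i < k" "i < k'" and n_def: "n + i + 1 = N"
begin

definition residue :: "nat \<Rightarrow> nat" where "residue j = j * a mod N"

definition floor_mult :: "nat \<Rightarrow> nat" where "floor_mult j = j * a div N"

text \<open>The step \<open>j + k\<close>, \<open>j + k - k'\<close> or \<open>j - k'\<close> leads
  to the next residue attained on \<open>0, ..., n\<close>.\<close>

definition exchange :: "nat \<Rightarrow> nat" where "exchange = composition_perm (k' - i) i (k - i)"

definition letter :: "nat \<Rightarrow> int" where
  "letter j = (if j < k' - i then - int b else if j < k' then int b' - int b else int b')"

definition trajectory :: "nat \<Rightarrow> nat" where "trajectory r = (exchange ^^ r) 0"

lemma N_ge_2: "N \<ge> 2"
  using length_sum i_less by linarith

lemma k_mult: "k * a = N * b + 1"
  using unimodular by (simp add: length_sum[symmetric] ones_sum[symmetric] algebra_simps)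

lemma k'_mult: "k' * a + 1 = N * b'"
  using unimodular by (simp add: length_sum[symmetric] ones_sum[symmetric] algebra_simps)

lemma coprime_ones_length: "coprime a N"
proof (rule coprimeI)
  fix d assume "d dvd a" "d dvd N"
  then have "d dvd k * a" "d dvd N * b" by simp_all
  then show "d dvd 1" using k_mult by (metis dvd_add_right_iff)
qed

lemma residue_inj: "inj_on residue {..<N}"
proof (rule inj_onI)
  fix x y assume xy: "x \<in> {..<N}" "y \<in> {..<N}" "residue x = residue y"
  then have "[x * a = y * a] (mod N)" by (simp add: residue_def cong_def)
  then have "[x = y] (mod N)" using coprime_ones_length by (simp add: cong_mult_rcancel_nat)
  then show "x = y" using xy by (simp add: cong_def)
qed

lemma residue_0 [simp]: "residue 0 = 0" and floor_mult_0 [simp]: "floor_mult 0 = 0"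
  by (simp_all add: residue_def floor_mult_def)

lemma residue_less: "residue j < N"
  using N_ge_2 by (simp add: residue_def)

lemma residue_pos: "0 < j \<Longrightarrow> j < N \<Longrightarrow> 0 < residue j"
  using inj_onD[OF residue_inj, of j 0] N_ge_2 by fastforce

lemma residue_k': "residue k' = N - 1"
proof -
  have "b' \<ge> 1" using k'_mult by (cases b') auto
  have "k' * a = N * (b' - 1) + (N - 1)"
  proof -
    have "N * b' = N * (b' - 1) + N" using \<open>b' \<ge> 1\<close> by (metis Suc_diff_1 Suc_le_eq One_nat_def mult_Suc_right add.commute)
    then show ?thesis using k'_mult N_ge_2 by linarith
  qed
  then show ?thesis using N_ge_2 unfolding residue_def by (simp only: mod_mult_self4) simp
qed

lemma exchange_le: "j \<le> n \<Longrightarrow> exchange j \<le> n"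
  using n_def i_less length_sum by (auto simp: exchange_def composition_perm_def)

lemma exchange_inj: "inj_on exchange {..n}"
  using n_def i_less length_sum
  by (auto simp: inj_on_def exchange_def composition_perm_def split: if_splits)

text \<open>Adding \<open>k\<close> or subtracting \<open>k'\<close> raises the residue by 1 modulo
  \<open>N\<close>. In the middle interval \<open>j + k\<close> exceeds \<open>n\<close> and
  \<open>j - k'\<close> is negative, so both moves are made and the residue rises by 2. The letters
  record the multiples of \<open>N\<close> involved.\<close>

lemma exchange_mult:
  assumes "j \<le> n"
  shows "int (exchange j * a) = int (j * a) - int N * letter j + (if k' - i \<le> j \<and> j < k' then 2 else 1)"
proof -
  have k: "int k * int a = int N * int b + 1" using k_mult by (metis of_nat_1 of_nat_add of_nat_mult)
  have k': "int k' * int a = int N * int b' - 1" using k'_mult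
    by (metis add_diff_cancel_right' of_nat_1 of_nat_add of_nat_mult)
  consider "j < k' - i" | "k' - i \<le> j" "j < k'" | "k' \<le> j" by linarith
  then show ?thesis
  proof cases
    case 1
    then have "exchange j = j + k" using i_less by (simp add: exchange_def composition_perm_def)
    then show ?thesis using 1 k by (simp add: letter_def algebra_simps)
  next
    case 2
    then have "exchange j = j + k - k'" using i_less by (simp add: exchange_def composition_perm_def)
    moreover have "k' \<le> j + k" using 2 i_less by linarith
    ultimately have "int (exchange j) = int j + int k - int k'" by (simp add: of_nat_diff)
    then have "int (exchange j) * int a = (int j + int k - int k') * int a" by simp
    then show ?thesis using 2 k k' by (simp add: letter_def algebra_simps)
  next
    case 3
    have "\<not> j < k' - i" "\<not> j < k' - i + i" "j < k' - i + i + (k - i)" "k' - i + i = k'"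
      using 3 i_less assms n_def length_sum by linarith+
    then have "exchange j = j - k'" by (simp add: exchange_def composition_perm_def)
    then have "int (exchange j) * int a = (int j - int k') * int a" using 3 by (simp add: of_nat_diff)
    moreover have "letter j = int b'" using 3 by (simp add: letter_def)
    ultimately show ?thesis using 3 k' by (simp add: algebra_simps)
  qed
qed

lemma mult_eq_floor_mult_residue: "int (j * a) = int N * int (floor_mult j) + int (residue j)"
  unfolding floor_mult_def residue_def by (metis mult_div_mod_eq of_nat_add of_nat_mult)

text \<open>Residues lie below \<open>N\<close> and the increment is 1 or 2, which leaves only 0 and
  -1 for \<open>M\<close>. The value -1 means passing \<open>N\<close>, and this happens exactly on
  returning to index 0.\<close>

lemma exchange_step:
  assumes "j \<le> n"
  shows "exchange j \<noteq> 0 \<Longrightarrow> residue j < residue (exchange j)"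
    and "exchange j \<noteq> 0 \<Longrightarrow> letter j = int (floor_mult j) - int (floor_mult (exchange j))"
    and "exchange j = 0 \<Longrightarrow> letter j = int (floor_mult j) + 1"
proof -
  let ?e = "exchange j"
  define \<delta> :: int where "\<delta> = (if k' - i \<le> j \<and> j < k' then 2 else 1)"
  define M where "M = int (floor_mult j) - letter j - int (floor_mult ?e)"
  have \<delta>: "\<delta> = 1 \<or> \<delta> = 2" by (simp add: \<delta>_def)
  have eq: "int N * M = int (residue ?e) - int (residue j) - \<delta>"
    using exchange_mult[OF assms] mult_eq_floor_mult_residue[of j] mult_eq_floor_mult_residue[of ?e]
    unfolding M_def \<delta>_def[symmetric] by (simp add: algebra_simps)
  have b: "int (residue ?e) < int N" "int (residue j) < int N" using residue_less by simp_all
  have up: "M < 1"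
  proof (rule ccontr)
    assume "\<not> M < 1"
    then have "int N * 1 \<le> int N * M" by (intro mult_left_mono) auto
    then show False using eq b \<delta> by auto
  qed
  have lo: "- 2 < M"
  proof (rule ccontr)
    assume "\<not> - 2 < M"
    then have "int N * M \<le> int N * (- 2)" by (intro mult_left_mono) auto
    then show False using eq b \<delta> N_ge_2 by auto
  qed
  have "j < N" "?e < N" using assms exchange_le[OF assms] n_def by simp_all
  { assume "?e \<noteq> 0"
    \<comment> \<open>Landing on a positive residue after passing \<open>N\<close> needs increment 2
      from residue \<open>N - 1\<close>; that residue belongs to \<open>k'\<close>, whose increment
      is 1.\<close>
    have "M \<noteq> -1"
    proof
      assume "M = -1"
      then have *: "int (residue ?e) = int (residue j) + \<delta> - int N" using eq by simp
      have "residue ?e > 0" using residue_pos \<open>?e \<noteq> 0\<close> \<open>?e < N\<close> by simp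
      then have "\<delta> = 2" "residue j = N - 1" using * b \<delta> by linarith+
      then have "j = k'" using inj_onD[OF residue_inj, of j k'] residue_k' \<open>j < N\<close> i_less length_sum by simp
      then show False using \<open>\<delta> = 2\<close> by (simp add: \<delta>_def)
    qed
    then have "M = 0" using lo up by simp
    then show "residue j < residue ?e" "letter j = int (floor_mult j) - int (floor_mult ?e)"
      using eq \<delta> by (auto simp: M_def) }
  { assume "?e = 0"
    then have "M < 0" using eq \<delta> up by (cases "M = 0") auto
    then have "M = -1" using lo by simp
    then show "letter j = int (floor_mult j) + 1" using \<open>?e = 0\<close> by (simp add: M_def) }
qed

lemma trajectory_bij: "bij_betw trajectory {..n} {..n}"
  and trajectory_return: "trajectory (Suc n) = 0"
  and residue_trajectory_mono: "\<And>r s. r < s \<Longrightarrow> s \<le> n \<Longrightarrow> residue (trajectory r) < residue (trajectory s)"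
  using increasing_cycle[of n exchange residue, OF exchange_le exchange_inj exchange_step(1)]
  unfolding trajectory_def[abs_def] by blast+

lemma trajectory_0 [simp]: "trajectory 0 = 0"
  and trajectory_Suc: "trajectory (Suc r) = exchange (trajectory r)"
  by (simp_all add: trajectory_def)

lemma trajectory_le: "r \<le> n \<Longrightarrow> trajectory r \<le> n"
  using trajectory_bij by (auto simp: bij_betw_def)

lemma trajectory_surj:
  assumes "j \<le> n"
  obtains s where "s \<le> n" "j = trajectory s"
  using assms trajectory_bij unfolding bij_betw_def by (metis atMost_iff imageE)

lemma exchange_cyclic: "cyclic_on exchange {0..<n + 1}"
proof (rule cyclic_on_singleI)
  have orb: "trajectory (Suc r) \<in> orbit exchange 0" for r
    by (induction r) (auto simp: trajectory_Suc[of 0] trajectory_Suc[of "Suc _"] intro: orbit.intros)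
  show "{0..<n + 1} = orbit exchange 0"
  proof
    show "{0..<n + 1} \<subseteq> orbit exchange 0"
    proof
      fix j assume "j \<in> {0..<n + 1}"
      then obtain s where "j = trajectory s" using trajectory_surj[of j] by auto
      \<comment> \<open>\<open>orbit\<close> begins with one application of the map, so index 0
        enters through the return \<open>trajectory (Suc n)\<close>.\<close>
      then show "j \<in> orbit exchange 0"
        using orb[of "s - 1"] orb[of n] trajectory_return by (cases s) auto
    qed
    show "orbit exchange 0 \<subseteq> {0..<n + 1}"
    proof
      fix x assume "x \<in> orbit exchange 0"
      then show "x \<in> {0..<n + 1}"
        by induction (use exchange_le in \<open>auto simp: less_Suc_eq_le\<close>)
    qed
  qed
qed simp

section \<open>Ranks of residues and the rows of the factor matrix\<close>

definition rank :: "nat \<Rightarrow> nat" where "rank j = card {l. l \<le> n \<and> residue l < residue j}"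

lemma rank_trajectory:
  assumes "s \<le> n"
  shows "rank (trajectory s) = s"
proof -
  have "{l. l \<le> n \<and> residue l < residue (trajectory s)} = trajectory ` {..<s}"
  proof (intro equalityI subsetI)
    fix l assume l: "l \<in> {l. l \<le> n \<and> residue l < residue (trajectory s)}"
    then obtain r where r: "r \<le> n" "l = trajectory r" using trajectory_surj by blast
    then have "r < s" using l residue_trajectory_mono[of s r] by (cases r s rule: linorder_cases) auto
    then show "l \<in> trajectory ` {..<s}" using r by simp
  qed (use assms residue_trajectory_mono trajectory_le in auto)
  moreover have "inj_on trajectory {..<s}"
    using trajectory_bij assms by (auto simp: bij_betw_def intro: inj_on_subset)
  ultimately show ?thesis by (simp add: rank_def card_image)
qed

lemma residue_less_iff_rank:
  assumes "r \<le> n" "j \<le> n"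
  shows "residue (trajectory r) < residue j \<longleftrightarrow> r < rank j"
proof -
  obtain s where s: "s \<le> n" "j = trajectory s" using trajectory_surj assms by blast
  show ?thesis unfolding s(2) rank_trajectory[OF s(1)]
    using residue_trajectory_mono[of r s] residue_trajectory_mono[of s r] assms s
    by (cases r s rule: linorder_cases) auto
qed

text \<open>The intercepts that agree on the first \<open>n\<close> letters form an interval; \<open>row_word\<close> uses its largest
  element.\<close>

definition row_word :: "nat \<Rightarrow> int list" where
  "row_word r = mechanical_word a N (N - 1 - residue (trajectory r)) n"

text \<open>With \<open>x\<close> the residue of the row, adding \<open>N - 1 - x\<close> to
  \<open>residue j\<close> produces a carry exactly when \<open>x < residue j\<close>.\<close>

lemma row_partial_sum:
  assumes "r \<le> n" "j \<le> n"
  shows "(j * a + (N - 1 - residue (trajectory r))) div N = floor_mult j + of_bool (r < rank j)"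
proof -
  let ?x = "residue (trajectory r)"
  have x: "?x < N" "residue j < N" using residue_less by simp_all
  have "j * a + (N - 1 - ?x) = residue j + (N - 1 - ?x) + N * floor_mult j"
    unfolding residue_def floor_mult_def by (simp add: mult_div_mod_eq algebra_simps)
  moreover have "(y + N * floor_mult j) div N = floor_mult j + y div N" for y
    using N_ge_2 by simp
  ultimately have "(j * a + (N - 1 - ?x)) div N = floor_mult j + (residue j + (N - 1 - ?x)) div N"
    by metis
  moreover have "(residue j + (N - 1 - ?x)) div N = of_bool (?x < residue j)"
  proof (cases "?x < residue j")
    case True
    then have eq: "residue j + (N - 1 - ?x) = N + (residue j - ?x - 1)" using x by linarith
    have "(N + y) div N = 1" if "y < N" for y using that N_ge_2 by simp
    moreover have "residue j - ?x - 1 < N" using x by linarith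
    ultimately have "(residue j + (N - 1 - ?x)) div N = 1" unfolding eq by blast
    then show ?thesis using True by simp
  next
    case False
    then show ?thesis using x by (simp add: div_less)
  qed
  ultimately show ?thesis using residue_less_iff_rank[OF assms] by simp
qed

lemma nth_row_word:
  assumes "r \<le> n" "j < n"
  shows "row_word r ! j = (int (floor_mult (Suc j)) + of_bool (r < rank (Suc j))) -
    (int (floor_mult j) + of_bool (r < rank j))"
  using assms row_partial_sum[of r "Suc j"] row_partial_sum[of r j]
  by (simp add: row_word_def nth_mechanical_word)

lemma row_word_decreasing:
  assumes "r < s" "s \<le> n"
  shows "row_word s < row_word r"
proof (rule list_less_by_partial_sums)
  have sum: "sum_list (take j (row_word t)) = int (floor_mult j) + of_bool (t < rank j)"
    if "j \<le> n" "t \<le> n" for j t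
    using that row_partial_sum[of t j] residue_less[of "trajectory t"] N_ge_2
    by (simp add: row_word_def sum_list_take_mechanical_word)
  show "length (row_word s) = length (row_word r)" by (simp add: row_word_def)
  show "sum_list (take j (row_word s)) \<le> sum_list (take j (row_word r))" if "j \<le> length (row_word s)" for j
    using that sum[of j s] sum[of j r] assms by (simp add: row_word_def)
  \<comment> \<open>The prefix of length \<open>trajectory s\<close> has rank \<open>s\<close>, so
    its step separates row \<open>r < s\<close> from row \<open>s\<close>.\<close>
  show "row_word s \<noteq> row_word r"
    using sum[of "trajectory s" s] sum[of "trajectory s" r] assms trajectory_le[of s]
      rank_trajectory[of s] by auto
qed

lemma factor_matrix_eq:
  assumes st: "sturmian g"
    and sub: "\<And>\<rho>. \<rho> < N \<Longrightarrow> mechanical_word a N \<rho> n \<in> factors_of_length g n"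
  shows "factor_matrix g n = mat (n + 1) n (\<lambda>(r, j). row_word r ! j)"
proof -
  let ?xs = "map row_word [0..<n + 1]"
  have inj: "inj_on row_word {..n}"
    by (rule inj_onI) (metis atMost_iff less_irrefl linorder_neqE_nat row_word_decreasing)
  have "row_word ` {..n} \<subseteq> factors_of_length g n"
    using sub N_ge_2 by (auto simp: row_word_def)
  then have eq: "row_word ` {..n} = factors_of_length g n"
    using sturmian_card[OF st] sturmian_finite[OF st] card_image[OF inj]
    by (intro card_subset_eq) auto
  have "sorted_wrt (<) (rev ?xs)"
    unfolding sorted_wrt_rev
    by (auto simp: sorted_wrt_iff_nth_less row_word_decreasing simp del: upt_Suc)
  moreover have "set (rev ?xs) = factors_of_length g n"
    using eq by (auto simp: atLeast0LessThan lessThan_Suc_atMost simp del: upt_Suc)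
  ultimately have "sorted_list_of_set (factors_of_length g n) = rev ?xs"
    using sorted_list_of_set_unique[OF sturmian_finite[OF st], of "rev ?xs" n]
    by (simp add: sturmian_card[OF st] del: upt_Suc)
  then show ?thesis
    by (auto simp: factor_matrix_def mat_of_rows_list_def simp del: upt_Suc intro!: eq_matI)
qed

end

section \<open>Determinantal vectors\<close>

text \<open>Laplace expansion along a prepended column \<open>b\<close>; \<open>(-1) ^ n\<close>
  reconciles the cofactor sign \<open>(-1) ^ r\<close> with \<open>(-1) ^ (n - r)\<close>. Constant
  \<open>b\<close> gives the sum of the entries, a column of \<open>A\<close> gives
  orthogonality.\<close>

lemma minor_vec_inner_product:
  fixes A :: "'a :: comm_ring_1 mat"
  assumes A: "A \<in> carrier_mat (n + 1) n"
  shows "(\<Sum>r\<le>n. b r * minor_vec A $ r) =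
    (-1) ^ n * det (mat (n + 1) (n + 1) (\<lambda>(r, j). if j = 0 then b r else A $$ (r, j - 1)))"
proof -
  let ?B = "mat (n + 1) (n + 1) (\<lambda>(r, j). if j = 0 then b r else A $$ (r, j - 1))"
  have del: "mat_delete ?B r 0 = delete_row A r" if "r \<le> n" for r
  proof (rule eq_matI)
    have len: "length (take r (rows A) @ drop (Suc r) (rows A)) = n" using A that by auto
    then show "dim_row (mat_delete ?B r 0) = dim_row (delete_row A r)"
      "dim_col (mat_delete ?B r 0) = dim_col (delete_row A r)"
      using A by (simp_all add: mat_delete_def delete_row_def)
    fix i j assume "i < dim_row (delete_row A r)" "j < dim_col (delete_row A r)"
    then have ij: "i < n" "j < n" using A len by (simp_all add: delete_row_def)
    have "(take r (rows A) @ drop (Suc r) (rows A)) ! i = row A (if i < r then i else Suc i)"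
      using ij A that by (auto simp: nth_append min_def)
    then show "mat_delete ?B r 0 $$ (i, j) = delete_row A r $$ (i, j)"
      using ij A that len by (auto simp: mat_delete_def delete_row_def mat_of_rows_def)
  qed
  have "det ?B = (\<Sum>r<n + 1. ?B $$ (r, 0) * cofactor ?B r 0)"
    by (rule laplace_expansion_column) auto
  also have "\<dots> = (\<Sum>r\<le>n. b r * ((-1) ^ r * det (delete_row A r)))"
  proof (rule sum.cong)
    fix r assume "r \<in> {..n}"
    then have r: "r \<le> n" by simp
    have "cofactor ?B r 0 = (-1) ^ r * det (delete_row A r)"
      unfolding cofactor_def del[OF r] by simp
    then show "?B $$ (r, 0) * cofactor ?B r 0 = b r * ((-1) ^ r * det (delete_row A r))"
      using r by simp
  qed auto
  finally have "(-1) ^ n * det ?B = (\<Sum>r\<le>n. b r * ((-1) ^ n * (-1) ^ r * det (delete_row A r)))"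
    by (simp add: sum_distrib_left algebra_simps)
  also have "\<dots> = (\<Sum>r\<le>n. b r * minor_vec A $ r)"
  proof (rule sum.cong)
    fix r assume "r \<in> {..n}"
    then have r: "r \<le> n" by simp
    have "(-1 :: 'a) ^ n * (-1) ^ r = (-1) ^ (n - r)"
      using r by (metis le_add_diff_inverse2 minus_one_power_iff power_add even_add mult_minus1 mult_1 minus_minus mult.commute mult_minus_left)
    then show "b r * ((-1) ^ n * (-1) ^ r * det (delete_row A r)) = b r * minor_vec A $ r"
      using A r by (simp add: minor_vec_def)
  qed simp
  finally show ?thesis ..
qed

lemma minor_vec_orthogonal_column:
  fixes A :: "'a :: comm_ring_1 mat"
  assumes A: "A \<in> carrier_mat (n + 1) n" and "j < n"
  shows "(\<Sum>r\<le>n. A $$ (r, j) * minor_vec A $ r) = 0"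
proof -
  let ?B = "mat (n + 1) (n + 1) (\<lambda>(r, i). if i = 0 then A $$ (r, j) else A $$ (r, i - 1))"
  have "det ?B = 0"
    by (rule det_identical_columns[of _ "n + 1" 0 "Suc j"]) (use \<open>j < n\<close> in \<open>auto intro!: eq_vecI\<close>)
  then show ?thesis using minor_vec_inner_product[OF A, of "\<lambda>r. A $$ (r, j)"] by simp
qed

text \<open>In all uses \<open>f 0\<close> is the minimum, so a step in column 0 would be empty; the
  constant column takes its place.\<close>

definition step_matrix :: "nat \<Rightarrow> (nat \<Rightarrow> nat) \<Rightarrow> int mat" where
  "step_matrix n f = mat (n + 1) (n + 1)
     (\<lambda>(r, j). if j = 0 then 1 else of_bool (r < card {i. i \<le> n \<and> f i < f j}))"

text \<open>Subtracting row \<open>p + 1\<close> from row \<open>p\<close>, where \<open>p\<close> is the jump of the last column, leaves a unit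
  vector in row \<open>p\<close>.\<close>

lemma det_step_matrix_Suc:
  assumes inj: "inj_on f {..Suc n}" and zero: "\<And>j. 0 < j \<Longrightarrow> j \<le> Suc n \<Longrightarrow> f 0 < f j"
  shows "det (step_matrix (Suc n) f) =
    - ((-1) ^ card {i. i \<le> n \<and> f (Suc n) < f i} * det (step_matrix n f))"
proof -
  let ?M = "step_matrix (Suc n) f"
  define rk where "rk = (\<lambda>m j. card {i. i \<le> m \<and> f i < f j})"
  have fin: "finite {i. i \<le> m \<and> P i}" for m :: nat and P by simp
  define p where "p = rk n (Suc n) - 1"
  have rk_pos: "rk m j \<ge> 1" if "0 < j" "j \<le> Suc n" for m j
  proof -
    have "0 \<in> {i. i \<le> m \<and> f i < f j}" using zero that by simp
    then show ?thesis unfolding rk_def by (metis One_nat_def Suc_leI card_gt_0_iff empty_iff fin)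
  qed
  have rk_last: "rk (Suc n) (Suc n) = rk n (Suc n)"
    unfolding rk_def by (rule arg_cong[of _ _ card]) (auto simp: le_Suc_eq)
  have p1: "rk n (Suc n) = Suc p" using rk_pos[of "Suc n" n] by (simp add: p_def)
  have "rk n (Suc n) \<le> card {..n}" unfolding rk_def by (rule card_mono) auto
  then have pn: "p \<le> n" using p1 by simp
  have rk_Suc: "rk (Suc n) j = rk n j + of_bool (f (Suc n) < f j)" if "j \<le> n" for j
  proof (cases "f (Suc n) < f j")
    case True
    then have "{i. i \<le> Suc n \<and> f i < f j} = insert (Suc n) {i. i \<le> n \<and> f i < f j}" by (auto simp: le_Suc_eq)
    then show ?thesis using True by (simp add: rk_def)
  next
    case False
    then have "{i. i \<le> Suc n \<and> f i < f j} = {i. i \<le> n \<and> f i < f j}" by (auto simp: le_Suc_eq)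
    then show ?thesis using False by (simp add: rk_def)
  qed
  have rk_less: "rk n j \<le> p" if "j \<le> n" "f j < f (Suc n)" for j
  proof -
    have "{i. i \<le> n \<and> f i < f j} \<subset> {i. i \<le> n \<and> f i < f (Suc n)}" using that by auto
    then have "rk n j < rk n (Suc n)" unfolding rk_def by (intro psubset_card_mono) auto
    then show ?thesis using p1 by simp
  qed
  have rk_ge: "rk n j \<ge> Suc p" if "j \<le> n" "f (Suc n) < f j" for j
  proof -
    have "{i. i \<le> n \<and> f i < f (Suc n)} \<subseteq> {i. i \<le> n \<and> f i < f j}" using that by auto
    then have "rk n (Suc n) \<le> rk n j" unfolding rk_def by (intro card_mono) auto
    then show ?thesis using p1 by simp
  qed
  have ne: "f j < f (Suc n) \<or> f (Suc n) < f j" if "j \<le> n" for j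
    using inj_onD[OF inj, of j "Suc n"] that by fastforce
  have M: "?M \<in> carrier_mat (Suc (Suc n)) (Suc (Suc n))" by (simp add: step_matrix_def)
  define B where "B = addrow (-1) p (Suc p) ?M"
  have B: "B \<in> carrier_mat (Suc (Suc n)) (Suc (Suc n))" using M by (simp add: B_def)
  have Mij: "?M $$ (r, j) = (if j = 0 then 1 else of_bool (r < rk (Suc n) j))"
    if "r \<le> Suc n" "j \<le> Suc n" for r j
    using that by (simp add: step_matrix_def rk_def)
  have Bp: "B $$ (p, j) = of_bool (j = Suc n)" if jn: "j \<le> Suc n" for j
  proof -
    have eq: "B $$ (p, j) = ?M $$ (p, j) - ?M $$ (Suc p, j)"
      using jn M pn by (simp add: B_def mat_addrow_def)
    consider "j = 0" | "j = Suc n" | "0 < j" "j \<le> n" using jn by linarith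
    then have "?M $$ (p, j) - ?M $$ (Suc p, j) = of_bool (j = Suc n)"
    proof cases
      case 3
      show ?thesis
        using 3 ne[of j] rk_less[of j] rk_ge[of j] rk_Suc[of j] pn
        by (auto simp: Mij)
    qed (use pn p1 rk_last in \<open>auto simp: Mij\<close>)
    then show ?thesis using eq by simp
  qed
  have "det ?M = det B" unfolding B_def using M pn by (subst det_addrow) auto
  also have "\<dots> = (\<Sum>j<Suc (Suc n). B $$ (p, j) * cofactor B p j)"
    by (rule laplace_expansion_row[OF B]) (use pn in simp)
  also have "\<dots> = (\<Sum>j<Suc (Suc n). if j = Suc n then cofactor B p (Suc n) else 0)"
    by (rule sum.cong) (auto simp: Bp)
  also have "\<dots> = cofactor B p (Suc n)" by simp
  also have "\<dots> = (-1) ^ (p + Suc n) * det (mat_delete B p (Suc n))" by (simp add: cofactor_def)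
  also have "mat_delete B p (Suc n) = step_matrix n f"
  proof (rule eq_matI)
    show "dim_row (mat_delete B p (Suc n)) = dim_row (step_matrix n f)"
      "dim_col (mat_delete B p (Suc n)) = dim_col (step_matrix n f)"
      using B by (simp_all add: step_matrix_def)
    fix r j assume "r < dim_row (step_matrix n f)" "j < dim_col (step_matrix n f)"
    then have rj: "r \<le> n" "j \<le> n" by (simp_all add: step_matrix_def)
    \<comment> \<open>Ranks above that of the last column drop by one when index
      \<open>Suc n\<close> disappears, in step with the rows past the deleted row
      \<open>p\<close>.\<close>
    define r' where "r' = (if r < p then r else Suc r)"
    have "mat_delete B p (Suc n) $$ (r, j) = B $$ (r', j)"
      using rj B by (simp add: mat_delete_def r'_def)
    also have "\<dots> = ?M $$ (r', j)"
      using rj M by (simp add: B_def mat_addrow_def r'_def)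
    also have "\<dots> = (if j = 0 then 1 else of_bool (r < rk n j))"
      using rj ne[of j] rk_less[of j] rk_ge[of j] rk_Suc[of j] by (auto simp: Mij r'_def)
    finally show "mat_delete B p (Suc n) $$ (r, j) = step_matrix n f $$ (r, j)"
      using rj by (simp add: step_matrix_def rk_def)
  qed
  finally have "det ?M = (-1) ^ (p + Suc n) * det (step_matrix n f)" .
  moreover have "p + card {i. i \<le> n \<and> f (Suc n) < f i} = n"
  proof -
    have "{..n} = {i. i \<le> n \<and> f i < f (Suc n)} \<union> {i. i \<le> n \<and> f (Suc n) < f i}"
      using ne by auto
    moreover have "{i. i \<le> n \<and> f i < f (Suc n)} \<inter> {i. i \<le> n \<and> f (Suc n) < f i} = {}" by auto
    ultimately have "card {..n} = rk n (Suc n) + card {i. i \<le> n \<and> f (Suc n) < f i}"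
      unfolding rk_def by (metis card_Un_disjoint fin)
    then show ?thesis using p1 by simp
  qed
  then have "p + Suc n = 2 * p + Suc (card {i. i \<le> n \<and> f (Suc n) < f i})" by linarith
  then have "(-1 :: int) ^ (p + Suc n) = - ((-1) ^ card {i. i \<le> n \<and> f (Suc n) < f i})"
    by (simp only: power_add power_mult) simp
  ultimately show ?thesis by simp
qed

text \<open>Each removed index contributes -1 and the inversions it forms with smaller indices.
  Removal down to \<open>m = 0\<close> evaluates the identity, removal from \<open>N - 1\<close>
  down to \<open>n\<close> produces \<open>t\<close>.\<close>

lemma det_step_matrix_inversions:
  assumes inj: "inj_on f {..n}" and zero: "\<And>j. 0 < j \<Longrightarrow> j \<le> n \<Longrightarrow> f 0 < f j" and "m \<le> n"
  shows "det (step_matrix n f) =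
    (-1) ^ (n - m) * (-1) ^ (\<Sum>l = Suc m..n. card {i. i < l \<and> f l < f i}) * det (step_matrix m f)"
  using \<open>m \<le> n\<close> inj zero
proof (induction n rule: dec_induct)
  case (step n)
  have "inj_on f {..n}" using step.prems(1) by (rule inj_on_subset) auto
  then have IH: "det (step_matrix n f) =
    (-1) ^ (n - m) * (-1) ^ (\<Sum>l = Suc m..n. card {i. i < l \<and> f l < f i}) * det (step_matrix m f)"
    using step.IH step.prems(2) by simp
  have "{i. i \<le> n \<and> f (Suc n) < f i} = {i. i < Suc n \<and> f (Suc n) < f i}" by auto
  then show ?case
    using det_step_matrix_Suc[OF step.prems] IH step.hyps by (simp add: Suc_diff_le power_add)
qed simp

lemma det_step_matrix_id: "det (step_matrix n id) = (-1) ^ n"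
proof -
  have z: "(\<Sum>l = Suc 0..n. card {i. i < l \<and> id l < (id i :: nat)}) = 0"
    by (intro sum.neutral ballI) auto
  have "det (step_matrix 0 id) = 1"
    by (subst det_single) (auto simp: step_matrix_def)
  moreover have "det (step_matrix n id) = (-1) ^ (n - 0) *
      (-1) ^ (\<Sum>l = Suc 0..n. card {i. i < l \<and> id l < id i}) * det (step_matrix 0 id)"
    by (rule det_step_matrix_inversions) auto
  ultimately show ?thesis unfolding z by simp
qed

text \<open>The rank of \<open>\<tau> i\<close> is \<open>\<tau> i\<close> itself, so the columns
  are those of \<open>step_matrix n id\<close> permuted by \<open>\<tau>\<close>; transposing makes
  this a permutation of rows.\<close>

lemma det_step_matrix_permutes:
  assumes p: "\<tau> permutes {1..n}"
  shows "det (step_matrix n \<tau>) = sign \<tau> * (-1) ^ n"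
proof -
  have p0: "\<tau> permutes {0..<n + 1}" by (rule permutes_subset[OF p]) auto
  have t0: "\<tau> 0 = 0" using p by (simp add: permutes_def)
  let ?U = "step_matrix n id"
  have U: "?U \<in> carrier_mat (n + 1) (n + 1)" by (simp add: step_matrix_def)
  have M: "step_matrix n \<tau> \<in> carrier_mat (n + 1) (n + 1)" by (simp add: step_matrix_def)
  have le: "\<tau> i \<le> n \<longleftrightarrow> i \<le> n" for i using permutes_in_image[OF p0, of i] by auto
  have "transpose_mat (step_matrix n \<tau>) = mat (n + 1) (n + 1) (\<lambda>(i, j). transpose_mat ?U $$ (\<tau> i, j))"
  proof (rule eq_matI)
    fix i j assume "i < dim_row (mat (n + 1) (n + 1) (\<lambda>(i, j). transpose_mat ?U $$ (\<tau> i, j)))"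
      "j < dim_col (mat (n + 1) (n + 1) (\<lambda>(i, j). transpose_mat ?U $$ (\<tau> i, j)))"
    then have ij: "i \<le> n" "j \<le> n" by auto
    have "\<tau> ` {k. k \<le> n \<and> \<tau> k < \<tau> i} = {k. k \<le> n \<and> k < \<tau> i}"
      using le permutes_surj[OF p] by (auto simp: image_iff) (metis le surjD)
    then have "card {k. k \<le> n \<and> \<tau> k < \<tau> i} = card {k. k \<le> n \<and> k < \<tau> i}"
      by (metis card_image permutes_inj_on[OF p])
    moreover have "\<tau> i = 0 \<longleftrightarrow> i = 0" using t0 permutes_inj[OF p] by (metis injD)
    moreover have "transpose_mat ?U $$ (\<tau> i, j) = ?U $$ (j, \<tau> i)"
      using U ij le[of i] by simp
    moreover have "?U $$ (j, \<tau> i) = (if \<tau> i = 0 then 1 else of_bool (j < card {k. k \<le> n \<and> k < \<tau> i}))"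
      using ij le[of i] by (simp add: step_matrix_def)
    moreover have "transpose_mat (step_matrix n \<tau>) $$ (i, j)
        = (if i = 0 then 1 else of_bool (j < card {k. k \<le> n \<and> \<tau> k < \<tau> i}))"
      using ij by (simp add: step_matrix_def)
    ultimately show "transpose_mat (step_matrix n \<tau>) $$ (i, j)
        = mat (n + 1) (n + 1) (\<lambda>(i, j). transpose_mat ?U $$ (\<tau> i, j)) $$ (i, j)"
      using ij by simp
  qed (simp_all add: step_matrix_def)
  then have "det (transpose_mat (step_matrix n \<tau>)) = signof \<tau> * det (transpose_mat ?U)"
    using det_permute_rows[OF transpose_carrier_mat[THEN iffD2, OF U] p0] by simp
  then show ?thesis by (simp add: det_transpose[OF M] det_transpose[OF U] det_step_matrix_id)
qed

text \<open>The columns of \<open>A\<close> are differences of successive steps plus constants, so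
  the bordered matrix is the step matrix times a unitriangular one.\<close>

lemma det_step_augmented:
  fixes c :: "nat \<Rightarrow> int"
  assumes A: "A \<in> carrier_mat (n + 1) n" and "c 0 = 0"
    and Aij: "\<And>r j. r \<le> n \<Longrightarrow> j < n \<Longrightarrow> A $$ (r, j) =
      (c (Suc j) + of_bool (r < rk (Suc j))) - (c j + of_bool (0 < j \<and> r < rk j))"
    and rk: "\<And>j. 0 < j \<Longrightarrow> j \<le> n \<Longrightarrow> rk j = card {i. i \<le> n \<and> f i < f j}"
  shows "det (mat (n + 1) (n + 1) (\<lambda>(r, j). if j = 0 then 1 else A $$ (r, j - 1))) = det (step_matrix n f)"
proof -
  let ?B = "mat (n + 1) (n + 1) (\<lambda>(r, j). if j = 0 then 1 else A $$ (r, j - 1))"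
  let ?M = "step_matrix n f"
  \<comment> \<open>The clause \<open>s = 0\<close> comes before \<open>Suc s = j\<close>: for
    \<open>j = 1\<close> only a multiple of the constant column is added, since index 0 has an empty
    step while column 0 holds ones.\<close>
  define Q :: "int mat" where "Q = mat (n + 1) (n + 1)
    (\<lambda>(s, j). if s = j then 1 else if s = 0 then c j - c (j - 1) else if Suc s = j then -1 else 0)"
  have Q: "Q \<in> carrier_mat (n + 1) (n + 1)" by (simp add: Q_def)
  have M: "?M \<in> carrier_mat (n + 1) (n + 1)" by (simp add: step_matrix_def)
  have "det Q = prod_list (diag_mat Q)"
    by (rule det_upper_triangular[OF _ Q]) (auto simp: Q_def)
  also have "diag_mat Q = replicate (n + 1) 1"
    by (rule nth_equalityI) (auto simp: diag_mat_def Q_def simp del: upt_Suc replicate_Suc)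
  finally have "det Q = 1" by simp
  have "?B = ?M * Q"
  proof (rule eq_matI)
    fix r j assume "r < dim_row (?M * Q)" "j < dim_col (?M * Q)"
    then have rj: "r \<le> n" "j \<le> n" by (simp_all add: step_matrix_def Q_def)
    define m where "m = (\<lambda>s. ?M $$ (r, s))"
    have ms: "m s = (if s = 0 then 1 else of_bool (r < rk s))" if "s \<le> n" for s
      using that rj rk by (simp add: m_def step_matrix_def)
    have "(?M * Q) $$ (r, j) = (\<Sum>s = 0..<n + 1. m s * Q $$ (s, j))"
      using rj M Q by (simp add: scalar_prod_def m_def)
    also have "\<dots> = (\<Sum>s = 0..<n + 1. (if s = j then m s else 0) +
      (if s = 0 then (if j = 0 then 0 else m s * (c j - c (j - 1))) else 0) +
      (if s = j - 1 then (if j \<le> 1 then 0 else - m s) else 0))"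
      by (rule sum.cong) (use rj in \<open>auto simp: Q_def\<close>)
    also have "\<dots> = m j + (if j = 0 then 0 else m 0 * (c j - c (j - 1))) + (if j \<le> 1 then 0 else - m (j - 1))"
      using rj by (simp add: sum.distrib) presburger
    also have "\<dots> = ?B $$ (r, j)"
    proof (cases j)
      case (Suc i)
      then show ?thesis using rj Aij[of r i] \<open>c 0 = 0\<close> ms[of 0] ms[of j] ms[of "j - 1"]
        by (cases i) auto
    qed (use rj ms[of 0] in simp)
    finally show "?B $$ (r, j) = (?M * Q) $$ (r, j)" ..
  qed (simp_all add: step_matrix_def Q_def)
  then show ?thesis using det_mult[OF M Q] \<open>det Q = 1\<close> by simp
qed

section \<open>The determinantal vectors of a Sturmian sequence\<close>

context christoffel_pair
begin

lemma minor_vec_row_words: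
  defines "A \<equiv> mat (n + 1) n (\<lambda>(r, j). row_word r ! j)"
  assumes "r \<le> n"
  shows "minor_vec A $ r = (-1) ^ n * det (step_matrix n residue) * letter (trajectory r)"
proof -
  define T where "T = (-1) ^ n * det (step_matrix n residue)"
  define V where "V = (\<lambda>r. minor_vec A $ r)"
  define c where "c = (\<lambda>j. int (floor_mult j))"
  have A: "A \<in> carrier_mat (n + 1) n" by (simp add: A_def)
  have rank0: "rank 0 = 0" using rank_trajectory[of 0] by simp
  have Aij: "A $$ (r, j) = (c (Suc j) + of_bool (r < rank (Suc j))) - (c j + of_bool (r < rank j))"
    if "r \<le> n" "j < n" for r j
    using that by (simp add: A_def c_def nth_row_word)
  have total: "(\<Sum>r\<le>n. V r) = T"
  proof -
    have "det (mat (n + 1) (n + 1) (\<lambda>(r, j). if j = 0 then 1 else A $$ (r, j - 1))) =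
        det (step_matrix n residue)"
    proof (rule det_step_augmented[OF A, of c rank])
      show "A $$ (r, j) = (c (Suc j) + of_bool (r < rank (Suc j))) - (c j + of_bool (0 < j \<and> r < rank j))"
        if "r \<le> n" "j < n" for r j
        using Aij[OF that] rank0 by (cases j) auto
    qed (simp_all add: c_def rank_def)
    then show ?thesis using minor_vec_inner_product[OF A, of "\<lambda>_. 1"] by (simp add: V_def T_def)
  qed
  \<comment> \<open>Columns \<open>0, ..., j - 1\<close> of \<open>A\<close> telescope to the
    partial sums of length \<open>j\<close>, which are therefore orthogonal to \<open>V\<close>
    too.\<close>
  have orth: "(\<Sum>r\<le>n. (c j + of_bool (r < rank j)) * V r) = 0" if "j \<le> n" for j
    using that
  proof (induction j)
    case 0
    then show ?case by (simp add: c_def rank0)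
  next
    case (Suc j)
    have "(\<Sum>r\<le>n. (c (Suc j) + of_bool (r < rank (Suc j))) * V r)
        = (\<Sum>r\<le>n. A $$ (r, j) * V r + (c j + of_bool (r < rank j)) * V r)"
      by (rule sum.cong) (use Suc.prems in \<open>auto simp: Aij algebra_simps\<close>)
    also have "\<dots> = 0"
      using Suc minor_vec_orthogonal_column[OF A, of j] by (simp add: sum.distrib V_def)
    finally show ?case .
  qed
  \<comment> \<open>At index \<open>trajectory s\<close> the step has rank \<open>s\<close> and cuts
    off exactly the first \<open>s\<close> entries.\<close>
  have prefix: "(\<Sum>r<s. V r) = - c (trajectory s) * T" if "s \<le> n" for s
  proof -
    have "(\<Sum>r\<le>n. of_bool (r < s) * V r) = (\<Sum>r<s. V r)"
      by (rule sum.mono_neutral_cong_right) (use that in auto)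
    moreover have "c (trajectory s) * (\<Sum>r\<le>n. V r) + (\<Sum>r\<le>n. of_bool (r < s) * V r) = 0"
      using orth[OF trajectory_le[OF that]]
      by (simp add: rank_trajectory[OF that] distrib_right sum.distrib sum_distrib_left)
    ultimately show ?thesis using total by simp
  qed
  have "V r = T * letter (trajectory r)"
  proof (cases "r = n")
    case True
    \<comment> \<open>The last entry is \<open>T\<close> minus the final prefix sum; this extra
      \<open>T\<close> matches the \<open>+ 1\<close> in \<open>exchange_step(3)\<close>.\<close>
    have "exchange (trajectory n) = 0" using trajectory_return by (simp add: trajectory_Suc)
    then have "letter (trajectory n) = c (trajectory n) + 1"
      using exchange_step(3)[of "trajectory n"] trajectory_le[of n] by (simp add: c_def)
    moreover have "(\<Sum>r\<le>n. V r) = (\<Sum>r<n. V r) + V n" by (simp add: lessThan_Suc_atMost[symmetric])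
    ultimately show ?thesis using prefix[of n] total True by (simp add: algebra_simps)
  next
    case False
    then have r: "r < n" using assms by simp
    have "trajectory (Suc r) \<noteq> 0"
      using residue_trajectory_mono[of 0 "Suc r"] r by (metis Suc_leI less_irrefl trajectory_0 zero_less_Suc)
    then have l: "letter (trajectory r) = c (trajectory r) - c (trajectory (Suc r))"
      using exchange_step(2)[of "trajectory r"] trajectory_le[of r] r by (simp add: c_def trajectory_Suc)
    have "V r = (\<Sum>r<Suc r. V r) - (\<Sum>r<r. V r)" by simp
    also have "\<dots> = - c (trajectory (Suc r)) * T - - c (trajectory r) * T"
      using prefix[of r] prefix[of "Suc r"] r by (simp only: Suc_leI less_imp_le)
    also have "\<dots> = T * letter (trajectory r)" unfolding l by (simp add: algebra_simps)
    finally show ?thesis .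
  qed
  then show ?thesis by (simp add: V_def T_def)
qed

section \<open>The letters along the trajectory as composition word and as Christoffel word\<close>

lemma composition_word_eq:
  "composition_word (- int b) (int b' - int b) (int b') (k' - i) i (k - i) =
    map (\<lambda>r. letter (trajectory r)) [0..<n + 1]"
proof -
  have "k' - i + i + (k - i) = n + 1" "k' - i + i = k'"
    using i_less length_sum n_def by linarith+
  then show ?thesis
    unfolding composition_word_def trajectory_def exchange_def letter_def Let_def by simp
qed

lemma single_cycle_composition: "single_cycle (k' - i) i (k - i)"
proof -
  have "k' - i + i + (k - i) = n + 1" using i_less length_sum n_def by linarith
  then show ?thesis using exchange_cyclic unfolding single_cycle_def exchange_def by simp
qed

text \<open>Without a middle interval \<open>exchange\<close> is the rotation by \<open>k\<close>
  modulo \<open>N\<close>, and the floor of \<open>r * k / N\<close> jumps exactly where the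
  rotation wraps, that is from residues not below \<open>k'\<close>.\<close>

lemma christoffel_word_eq:
  assumes "i = 0"
  shows "christoffel_word (- int b) (int b') k' k = map (\<lambda>r. letter (trajectory r)) [0..<n + 1]"
proof -
  have nN: "n + 1 = N" using n_def assms by simp
  have traj: "trajectory r = r * k mod N" for r
  proof (induction r)
    case (Suc r)
    have ex: "exchange y = (if y < k' then y + k else if y < k' + k then y - k' else y)" for y
      unfolding exchange_def composition_perm_def using assms by simp
    define x where "x = r * k mod N"
    have x: "x < N" using N_ge_2 by (simp add: x_def)
    have "exchange x = (x + k) mod N"
    proof (cases "x < k'")
      case True
      then show ?thesis using length_sum by (simp add: ex)
    next
      case False
      then have "(x + k) mod N = x + k - N"
        using x length_sum i_less by (simp add: le_mod_geq)
      then show ?thesis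
        using False x length_sum by (simp add: ex)
    qed
    then show ?case using Suc
      by (simp add: trajectory_Suc x_def mod_add_right_eq add.commute)
  qed simp
  have "(Suc r * k) div N > r * k div N \<longleftrightarrow> \<not> r * k mod N < k'" for r
  proof -
    have "Suc r * k = (r * k mod N + k) + N * (r * k div N)"
      by (simp add: mult_div_mod_eq algebra_simps)
    moreover have "(y + N * z) div N = z + y div N" for y z using N_ge_2 by simp
    ultimately have "(Suc r * k) div N = r * k div N + (r * k mod N + k) div N" by metis
    moreover have "(r * k mod N + k) div N > 0 \<longleftrightarrow> \<not> r * k mod N < k'"
      using N_ge_2 length_sum by (auto simp: div_greater_zero_iff)
    ultimately show ?thesis by linarith
  qed
  then show ?thesis
    unfolding christoffel_word_def nN letter_def traj using length_sum assms
    by (intro map_cong) (auto simp: add.commute[of k'])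
qed

text \<open>Since \<open>q = N - a\<close>, the numbers \<open>j * q\<close> and
  \<open>(N - j) * a\<close> agree modulo \<open>N\<close>. Exactly \<open>N - 1 - v\<close> indices
  have residue above \<open>v = residue (N - j)\<close>; those past \<open>N - j\<close> correspond
  to the \<open>j' < j\<close> of larger residue, which \<open>rank_count\<close> counts by
  complement.\<close>

lemma inversions_at:
  assumes q: "a + q = N" and j: "1 \<le> j" "j < N"
  shows "int (card {m. m < N - j \<and> residue (N - j) < residue m}) =
    int N - int j + int (rank_count N q j) - int (j * q mod N)"
proof -
  have mult: "j * q mod N = residue (N - j)" if "j < N" for j
  proof -
    have "int q = int N - int a" "int (N - j) = int N - int j" using q that by simp_all
    then have "int ((N - j) * a) = int (j * q) + int N * (int a - int j)"
      unfolding of_nat_mult by (simp only:) (simp add: algebra_simps)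
    then have "int ((N - j) * a) mod int N = int (j * q) mod int N" by simp
    then show ?thesis unfolding residue_def by (metis of_nat_eq_iff zmod_int)
  qed
  let ?v = "residue (N - j)"
  have bij: "residue ` {..<N} = {..<N}"
    by (rule card_subset_eq) (use residue_less card_image[OF residue_inj] in auto)
  have "residue ` {m. m < N \<and> ?v < residue m} = {?v<..<N}"
    using bij by (auto simp: set_eq_iff image_iff residue_less) (metis lessThan_iff imageE)
  then have "card {m. m < N \<and> ?v < residue m} = card {?v<..<N}"
    by (metis (no_types, lifting) card_image inj_on_subset lessThan_iff mem_Collect_eq residue_inj subsetI)
  moreover have "{m. m < N \<and> ?v < residue m} = {m. m < N - j \<and> ?v < residue m} \<union>
      (\<lambda>j'. N - j') ` {j' \<in> {1..j}. ?v < residue (N - j')}" (is "?X = ?Y \<union> ?Z")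
  proof (intro equalityI subsetI)
    fix m assume m: "m \<in> ?X"
    show "m \<in> ?Y \<union> ?Z"
    proof (cases "m < N - j")
      case False
      then have "m = N - (N - m)" "N - m \<in> {1..j}" using m j by auto
      then show ?thesis using m by (intro UnI2 image_eqI[of _ _ "N - m"]) auto
    qed (use m in simp)
  qed (use j in auto)
  moreover have "card (?Y \<union> ?Z) = card ?Y + card ?Z"
    by (rule card_Un_disjoint) (use j in auto)
  moreover have "card ?Z = card {j' \<in> {1..j}. ?v < residue (N - j')}"
    by (rule card_image) (use j in \<open>auto simp: inj_on_def\<close>)
  ultimately have e1: "N - Suc ?v = card ?Y + card {j' \<in> {1..j}. ?v < residue (N - j')}" by simp
  have "{1..j} = {j' \<in> {1..j}. residue (N - j') < ?v} \<union> insert j {j' \<in> {1..j}. ?v < residue (N - j')}"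
    (is "_ = ?L \<union> insert j ?G")
  proof -
    have sub: "x \<in> ?L \<union> insert j ?G" if "x \<in> {1..j}" for x
      using inj_onD[OF residue_inj, of "N - x" "N - j"] that j
      by (cases "residue (N - x)" ?v rule: linorder_cases) auto
    show ?thesis by (intro equalityI subsetI, erule sub) (use j in auto)
  qed
  then have "card {1..j} = card (?L \<union> insert j ?G)" by (rule arg_cong)
  then have "card {1..j} = card ?L + card (insert j ?G)"
    by (subst card_Un_disjoint[symmetric]) auto
  then have "j = card ?L + Suc (card ?G)" by simp
  moreover have "?L = {j' \<in> {1..j}. j' * q mod N < j * q mod N}"
    using mult j by (auto simp: le_less_trans)
  ultimately have "j = rank_count N q j + Suc (card ?G)" by (simp only: rank_count_def)
  then show ?thesis
    unfolding mult[OF j(2)] using e1 residue_less[of "N - j"] by linarith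
qed

text \<open>Multiplication by \<open>a\<close> permutes the nonzero residues; its extension by the
  identity fixes 0, where \<open>residue\<close> vanishes as well.\<close>

lemma sign_residue_permutation:
  "det (step_matrix (N - 1) residue) = sign_on {1..<N} (\<lambda>x. a * x mod N) * (-1) ^ (N - 1)"
proof -
  define \<tau> where "\<tau> = restrict_id (\<lambda>x. a * x mod N) {1..<N}"
  have res: "a * x mod N = residue x" for x by (simp add: residue_def mult.commute)
  have "inj_on residue {1..<N}" by (rule inj_on_subset[OF residue_inj]) auto
  moreover have "residue ` {1..<N} \<subseteq> {1..<N}"
    using residue_pos residue_less by (auto simp: Suc_le_eq)
  ultimately have "bij_betw residue {1..<N} {1..<N}"
    by (simp add: bij_betw_def endo_inj_surj)
  then have "\<tau> permutes {1..<N}" unfolding \<tau>_def res by (rule permutes_restrict_id)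
  moreover have "{1..<N} = {1..N - 1}" using N_ge_2 by auto
  ultimately have "det (step_matrix (N - 1) \<tau>) = sign \<tau> * (-1) ^ (N - 1)"
    using det_step_matrix_permutes by simp
  moreover have "\<tau> j = residue j" if "j \<le> N - 1" for j
    using that N_ge_2 by (cases "j = 0") (auto simp: \<tau>_def res restrict_id_def)
  then have "step_matrix (N - 1) \<tau> = step_matrix (N - 1) residue"
    unfolding step_matrix_def by (intro eq_matI) (auto cong: conj_cong)
  ultimately show ?thesis by (simp add: sign_on_def \<tau>_def)
qed

text \<open>Removing the indices \<open>N - 1, ..., n + 1\<close> from the full step matrix costs
  \<open>i\<close> factors -1 besides the inversions; they cancel against the quotient of
  \<open>(-1) ^ (N - 1)\<close> and \<open>(-1) ^ n\<close>.\<close>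

lemma det_step_matrix_residue:
  assumes q: "a + q = N"
  shows "(-1) ^ n * det (step_matrix n residue) =
    sign_on {1..<N} (\<lambda>x. a * x mod N) * (-1) ^ nat \<bar>sign_exponent N q i\<bar>"
proof -
  define t where "t = (\<Sum>l = Suc n..N - 1. card {m. m < l \<and> residue l < residue m})"
  have "det (step_matrix (N - 1) residue) = (-1) ^ (N - 1 - n) * (-1) ^ t * det (step_matrix n residue)"
    unfolding t_def
  proof (rule det_step_matrix_inversions)
    show "inj_on residue {..N - 1}" by (rule inj_on_subset[OF residue_inj]) (use N_ge_2 in auto)
    show "residue 0 < residue j" if "0 < j" "j \<le> N - 1" for j using that residue_pos by simp
  qed (use n_def in simp)
  then have "sign_on {1..<N} (\<lambda>x. a * x mod N) * (-1) ^ (N - 1) =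
      (-1) ^ i * (-1) ^ t * det (step_matrix n residue)"
    unfolding sign_residue_permutation using n_def by (simp flip: n_def)
  moreover have "(-1 :: int) ^ (N - 1) = (-1) ^ n * (-1) ^ i"
    by (simp add: power_add flip: n_def)
  ultimately have "sign_on {1..<N} (\<lambda>x. a * x mod N) * (-1) ^ n = (-1) ^ t * det (step_matrix n residue)"
    by (simp add: mult.assoc[symmetric] mult.commute[of _ "(-1) ^ i"])
  then have "(-1) ^ n * det (step_matrix n residue) = sign_on {1..<N} (\<lambda>x. a * x mod N) * (-1) ^ t"
    by (cases "even n"; cases "even t") simp_all
  moreover have "int t = sign_exponent N q i"
  proof -
    have "t = (\<Sum>j = 1..i. card {m. m < N - j \<and> residue (N - j) < residue m})"
      unfolding t_def
      by (rule sum.reindex_bij_witness[of _ "\<lambda>j. N - j" "\<lambda>l. N - l"]) (use n_def in auto)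
    then show ?thesis
      unfolding sign_exponent_def using n_def
      by (simp add: inversions_at[OF q] del: of_nat_mult of_nat_diff)
  qed
  then have "nat \<bar>sign_exponent N q i\<bar> = t" by simp
  ultimately show ?thesis by simp
qed

end

text \<open>One end of the interval at depth \<nu> is the preceding node, the other an end of the
  preceding interval, so neither is longer than the preceding word. This bounds \<open>i\<close>
  later.\<close>

lemma stern_brocot_node_data:
  assumes "s > 0" and irr: "\<And>a b :: nat. b \<ge> 1 \<Longrightarrow> s * real b \<noteq> real a" and "slope g = s" and "\<nu> \<ge> 1"
  obtains l1 l2 r1 r2 where "associated_word g \<nu> = christoffel_word 0 1 (l2 + r2) (l1 + r1)"
    and "r1 * l2 = l1 * r2 + 1" and "l2 \<ge> 1" and "real l1 < s * real l2" and "s * real r2 < real r1"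
    and "l1 + l2 \<le> length (associated_word g (\<nu> - 1))" and "r1 + r2 \<le> length (associated_word g (\<nu> - 1))"
proof -
  obtain \<mu> where \<mu>: "\<nu> = Suc \<mu>" using \<open>\<nu> \<ge> 1\<close> by (cases \<nu>) auto
  obtain a b c d where I: "stern_brocot_interval s \<mu> = ((a, b), (c, d))"
    by (metis prod.exhaust)
  obtain l1 l2 r1 r2 where J: "stern_brocot_interval s \<nu> = ((l1, l2), (r1, r2))"
    by (metis prod.exhaust)
  have len: "length (associated_word g (\<nu> - 1)) = a + b + c + d"
    using I by (simp add: \<mu> associated_word_def stern_brocot_node_def mediant_def \<open>slope g = s\<close>)
  have "l1 + l2 \<le> a + b + c + d \<and> r1 + r2 \<le> a + b + c + d"
    using I J by (auto simp: \<mu> Let_def mediant_def split: if_splits)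
  moreover have "associated_word g \<nu> = christoffel_word 0 1 (l2 + r2) (l1 + r1)"
    using J by (simp add: associated_word_def stern_brocot_node_def mediant_def \<open>slope g = s\<close>)
  ultimately show ?thesis
    using that stern_brocot_interval_invariant[OF \<open>s > 0\<close> irr J] len by simp
qed

lemma sturmian_christoffel_pair:
  assumes st: "sturmian g" and "\<nu> \<ge> 1"
    and n_lo: "length (associated_word g (\<nu> - 1)) \<le> n"
    and n_hi: "n \<le> length (associated_word g \<nu>) - 1"
    and w: "w = associated_word g \<nu>" and N: "N = length w"
    and fac: "standard_factorization w w' w''"
  defines "a \<equiv> count_list w 1" and "i \<equiv> N - 1 - n"
  shows "christoffel_pair N a (length w') (length w'') (count_list w' 1) (count_list w'' 1) i n"
    and "factor_matrix g n = mat (n + 1) n (\<lambda>(r, j). christoffel_pair.row_word N a (length w') (length w'') i n r ! j)"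
    and "coprime (length w') (count_list w' 1)" and "a + count_list w 0 = N"
proof -
  obtain \<alpha> :: real where \<alpha>: "0 \<le> \<alpha>" "\<alpha> \<le> 1"
    and dens: "\<And>i k. \<bar>of_int (block_sum g i k) - of_nat k * \<alpha>\<bar> \<le> 1"
    using sturmian_density_exists[OF st] by auto
  have irr: "real k * \<alpha> \<noteq> of_int x" if "k \<ge> 1" for k x
  proof (cases "x \<ge> 0")
    case True
    then show ?thesis using sturmian_density_irrational[OF st dens that, of "nat x"] by simp
  next
    case False
    then have "of_int x < (0 :: real)" "0 \<le> real k * \<alpha>" using \<alpha> by simp_all
    then show ?thesis by linarith
  qed
  have "\<alpha> \<noteq> 0" "\<alpha> \<noteq> 1" using irr[of 1 0] irr[of 1 1] by auto
  then have \<alpha>01: "0 < \<alpha>" "\<alpha> < 1" using \<alpha> by simp_all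
  define s where "s = \<alpha> / (1 - \<alpha>)"
  have slope: "slope g = s" unfolding s_def by (rule slope_eq[OF st dens \<open>\<alpha> \<noteq> 1\<close>])
  have s_pos: "s > 0" using \<alpha>01 by (simp add: s_def)
  have s_irr: "s * real y \<noteq> real x" if "y \<ge> 1" for x y :: nat
  proof
    assume "s * real y = real x"
    then have "real (x + y) * \<alpha> = of_int (int x)" using \<alpha>01 by (simp add: s_def field_simps)
    then show False using irr[of "x + y" "int x"] that by simp
  qed
  obtain l1 l2 r1 r2 where word: "associated_word g \<nu> = christoffel_word 0 1 (l2 + r2) (l1 + r1)"
    and det: "r1 * l2 = l1 * r2 + 1" and "l2 \<ge> 1" and l: "real l1 < s * real l2" and r: "s * real r2 < real r1"
    and prev: "l1 + l2 \<le> length (associated_word g (\<nu> - 1))" "r1 + r2 \<le> length (associated_word g (\<nu> - 1))"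
    by (rule stern_brocot_node_data[OF s_pos s_irr slope \<open>\<nu> \<ge> 1\<close>])
  \<comment> \<open>Passing from ones over zeros to ones over length preserves the
    determinant.\<close>
  define L where "L = l1 + l2"
  define R where "R = r1 + r2"
  have "r1 \<ge> 1" using det by (cases r1) auto
  have LR: "L \<ge> 1" "R \<ge> 1" using \<open>l2 \<ge> 1\<close> \<open>r1 \<ge> 1\<close> by (simp_all add: L_def R_def)
  have NLR: "N = L + R" using N w word by (simp add: L_def R_def)
  have a: "a = l1 + r1" and p: "count_list w 0 = l2 + r2"
    using w word \<open>l2 \<ge> 1\<close> by (simp_all add: a_def count_list_christoffel_word)
  show ap: "a + count_list w 0 = N" using a p NLR by (simp add: L_def R_def)
  have det': "r1 * L = l1 * R + 1" using det by (simp add: L_def R_def algebra_simps)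
  have close: "\<bar>int N * block_sum g i k - int k * int a\<bar> < int N" if "0 < k" "k < N" for i k
  proof -
    have "\<bar>(int L + int R) * block_sum g i k - int k * (int l1 + int r1)\<bar> < int L + int R"
    proof (rule block_sum_close_to_mediant[of k \<alpha>])
      show "int r1 * int L = int l1 * int R + 1" using det' by (metis of_nat_1 of_nat_add of_nat_mult)
      show "real_of_int (int l1) < \<alpha> * real_of_int (int L)"
        using l \<alpha>01 by (simp add: s_def L_def field_simps)
      show "\<alpha> * real_of_int (int R) < real_of_int (int r1)"
        using r \<alpha>01 by (simp add: s_def R_def field_simps)
    qed (use that LR NLR irr dens in auto)
    then show ?thesis by (simp add: NLR a)
  qed
  have La: "L * a = N * l1 + 1" using det' by (simp add: NLR a algebra_simps)
  have cop: "coprime a N"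
  proof (rule coprimeI)
    fix d assume "d dvd a" "d dvd N"
    then have "d dvd L * a" "d dvd N * l1" by simp_all
    then show "d dvd 1" using La by (metis dvd_add_right_iff)
  qed
  then have cop': "coprime (l2 + r2) (l1 + r1)"
    using ap unfolding a p by (metis coprime_commute coprime_iff_gcd_eq_1 gcd_add2)
  note par = standard_factorization_parameters[OF cop' _ fac, unfolded w, OF word, folded w]
  have kN: "length w' + length w'' = N" using par(1) NLR by (simp add: L_def R_def)
  have ba: "count_list w' 1 + count_list w'' 1 = a" using par(2) a by simp
  show "coprime (length w') (count_list w' 1)" by (rule par(6))
  have "length w' * a = N * count_list w' 1 + 1"
    unfolding kN[symmetric] ba[symmetric] using par(3) by (simp add: algebra_simps)
  \<comment> \<open>Both \<open>length w'\<close> and \<open>L\<close> invert \<open>a\<close>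
    modulo \<open>N\<close> and lie strictly between 0 and \<open>N\<close>, so the given
    factorization has the lengths of the two Stern-Brocot ends.\<close>
  then have "[length w' * a = L * a] (mod N)" unfolding La cong_def by (simp only: mod_mult_self4)
  then have "[length w' = L] (mod N)" using cop by (simp add: cong_mult_rcancel_nat)
  then have kL: "length w' = L"
    using kN par(4,5) NLR LR by (simp add: cong_def)
  then have k'R: "length w'' = R" using kN NLR by simp
  have "i < L" "i < R" "n + i + 1 = N"
    using n_lo n_hi prev N w NLR LR by (simp_all add: i_def L_def R_def)
  then show pair: "christoffel_pair N a (length w') (length w'') (count_list w' 1) (count_list w'' 1) i n"
    using kN ba par(3) kL k'R by unfold_locales simp_all
  interpret christoffel_pair N a "length w'" "length w''" "count_list w' 1" "count_list w'' 1" i n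
    by (rule pair)
  have "mechanical_word a N \<rho> n \<in> factors_of_length g n" if "\<rho> < N" for \<rho>
    by (rule mechanical_word_factor[OF st _ close that]) (use NLR LR n_hi N w in auto)
  then show "factor_matrix g n = mat (n + 1) n (\<lambda>(r, j). row_word r ! j)"
    by (rule factor_matrix_eq[OF st])
qed

theorem theorem9:
  fixes g :: "nat \<Rightarrow> int" and n \<nu> N q :: nat and w w' w'' :: "int list" and \<epsilon> :: int
  assumes "sturmian g"
    and "n \<ge> 2"
    and "\<nu> \<ge> 1"
    and "length (associated_word g (\<nu> - 1)) \<le> n"
    and "n \<le> length (associated_word g \<nu>) - 1"
    and "w = associated_word g \<nu>"
    and "N = length w"
    and "q = count_list w 0"
    and "standard_factorization w w' w''"
    and "\<epsilon> = sign_on {1..<N} (\<lambda>x. count_list w 1 * x mod N)"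
  shows
    "(n = N - 1 \<longrightarrow>
        (let x = - int (count_list w' 1); y = int (count_list w'' 1)
         in x < y \<and> coprime (length w'') (length w') \<and>
            determinantal_vec g n =
              \<epsilon> \<cdot>\<^sub>v vec_of_list (christoffel_word x y (length w'') (length w'))))
     \<and> (length (associated_word g (\<nu> - 1)) \<le> n \<and> n < N - 1 \<longrightarrow>
        (let i = N - 1 - n;
             x = - int (count_list w' 1);
             y = int (count_list w'' 1) - int (count_list w' 1);
             z = int (count_list w'' 1);
             t = sign_exponent N q i
         in x < y \<and> y < z \<and> i \<le> length w'' \<and> i \<le> length w' \<and>
            single_cycle (length w'' - i) i (length w' - i) \<and>
            determinantal_vec g n =
              (\<epsilon> * (-1) ^ nat \<bar>t\<bar>) \<cdot>\<^sub>v
                vec_of_list (composition_word x y z (length w'' - i) i (length w' - i))))"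
proof -
  define a where "a = count_list w 1"
  define i where "i = N - 1 - n"
  define k where "k = length w'"
  define k' where "k' = length w''"
  define b where "b = count_list w' 1"
  define b' where "b' = count_list w'' 1"
  note facts = sturmian_christoffel_pair[OF assms(1,3,4,5,6,7,9),
      folded a_def i_def k_def k'_def b_def b'_def]
  interpret christoffel_pair N a k k' b b' i n by (rule facts(1))
  have aq: "a + q = N" using facts(4) assms(8) by simp
  define T where "T = (-1) ^ n * det (step_matrix n residue)"
  have "\<epsilon> = sign_on {1..<N} (\<lambda>x. a * x mod N)" using assms(10) by (simp add: a_def)
  then have T: "T = \<epsilon> * (-1) ^ nat \<bar>sign_exponent N q i\<bar>"
    unfolding T_def det_step_matrix_residue[OF aq] by simp
  have vec: "determinantal_vec g n = T \<cdot>\<^sub>v vec_of_list (map (\<lambda>r. letter (trajectory r)) [0..<n + 1])"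
  proof (rule eq_vecI)
    fix r assume "r < dim_vec (T \<cdot>\<^sub>v vec_of_list (map (\<lambda>r. letter (trajectory r)) [0..<n + 1]))"
    then have r: "r \<le> n" by simp
    then show "determinantal_vec g n $ r =
        (T \<cdot>\<^sub>v vec_of_list (map (\<lambda>r. letter (trajectory r)) [0..<n + 1])) $ r"
      unfolding determinantal_vec_def facts(2) minor_vec_row_words[OF r] T_def
      by (simp add: vec_of_list_index del: upt_Suc)
  qed (simp add: determinantal_vec_def facts(2) minor_vec_def)
  have b': "b' \<ge> 1" using unimodular by (cases b') auto
  have cop: "coprime k' k"
  proof (rule coprimeI)
    fix d assume "d dvd k'" "d dvd k"
    then have "d dvd k * b'" "d dvd k' * b" by simp_all
    then show "d dvd 1" using unimodular by (metis dvd_add_right_iff)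
  qed
  have "determinantal_vec g n = \<epsilon> \<cdot>\<^sub>v vec_of_list (christoffel_word (- int b) (int b') k' k)"
    if "n = N - 1"
  proof -
    have "i = 0" using that by (simp add: i_def)
    then show ?thesis using vec christoffel_word_eq T by (simp add: sign_exponent_def)
  qed
  \<comment> \<open>The upper two letters differ by \<open>b\<close>. Coprimality turns
    \<open>b = 0\<close> into \<open>k = 1\<close>, and \<open>i < k\<close> then leaves no middle
    interval.\<close>
  moreover have "b \<ge> 1" if "n < N - 1"
  proof (rule ccontr)
    assume "\<not> b \<ge> 1"
    then have "k = 1" using facts(3) by (simp add: not_le)
    then show False using i_less that by (simp add: i_def)
  qed
  ultimately show ?thesis
    using vec b' cop i_less single_cycle_composition
    unfolding Let_def T i_def[symmetric] k_def[symmetric] k'_def[symmetric] b_def[symmetric]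
      b'_def[symmetric] composition_word_eq
    by auto
qed

end
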